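(* For every odd integer $n \ge 5$ there exists a fully resolvable CMDRR$(3n, n)$.
   Context: A mixed doubles game is a match between two teams, each team consisting of one man and one woman; in a game $M_a F_b$ v $M_c F_d$, $M_a$ and $F_b$ are partners, $M_c$ and $F_d$ are partners, and each player of one team opposes each player of the other team. A complete mixed doubles round robin tournament CMDRR$(N,k)$ is a schedule (set) of mixed doubles games for $N$ men and $N$ women, of which $k$ men and $k$ women are paired into $k$ spouse pairs (a spouse pair is one man and one woman), such that: spouses never play in a game together as partners or opponents; every man and woman who are not spouses are partners exactly once and opponents exactly once; each player who has a spouse opposes every other player of the same sex exactly once; each player who does not have a spouse opposes some other same-sex player who does not have a spouse exactly twice and opposes all other same-sex players exactly once. The games are to be partitioned into rounds, each player playing in at most one game per round. A round is full if it involves all $2N$ players when $N$ is even, or all but 2 players when $N$ is odd; otherwise it is short. The CMDRR is fully resolvable if its games can be partitioned into rounds with at most one short round. *)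

theory Defs
  imports Main
begin

text \<open>Players: men M_0..M_{N-1} (numbers < N), women F_0..F_{N-1}.
  Spouse pairs: (M_i, F_i) for i < k (a fixed labelling; without loss of generality).
  A game ((a,b),(c,d)) is the game M_a F_b v M_c F_d.\<close>

type_synonym game = "(nat \<times> nat) \<times> (nat \<times> nat)"

definition spouses :: "nat \<Rightarrow> nat \<Rightarrow> nat \<Rightarrow> bool" where
  "spouses k m w \<longleftrightarrow> m = w \<and> m < k"

definition valid_game :: "nat \<Rightarrow> nat \<Rightarrow> game \<Rightarrow> bool" where
  "valid_game N k g = (case g of ((a,b),(c,d)) \<Rightarrow>
     a < N \<and> b < N \<and> c < N \<and> d < N \<and> a \<noteq> c \<and> b \<noteq> d \<and>
     \<not> (\<exists>m\<in>{a,c}. \<exists>w\<in>{b,d}. spouses k m w))"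

definition partner_count :: "game list \<Rightarrow> nat \<Rightarrow> nat \<Rightarrow> nat" where
  "partner_count G m w = length (filter (\<lambda>((a,b),(c,d)). (a = m \<and> b = w) \<or> (c = m \<and> d = w)) G)"

definition opp_count :: "game list \<Rightarrow> nat \<Rightarrow> nat \<Rightarrow> nat" where
  "opp_count G m w = length (filter (\<lambda>((a,b),(c,d)). (a = m \<and> d = w) \<or> (c = m \<and> b = w)) G)"

definition men_opp_count :: "game list \<Rightarrow> nat \<Rightarrow> nat \<Rightarrow> nat" where
  "men_opp_count G x y = length (filter (\<lambda>((a,b),(c,d)). (a = x \<and> c = y) \<or> (a = y \<and> c = x)) G)"

definition women_opp_count :: "game list \<Rightarrow> nat \<Rightarrow> nat \<Rightarrow> nat" where
  "women_opp_count G x y = length (filter (\<lambda>((a,b),(c,d)). (b = x \<and> d = y) \<or> (b = y \<and> d = x)) G)"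

definition same_sex_cond :: "nat \<Rightarrow> nat \<Rightarrow> (nat \<Rightarrow> nat \<Rightarrow> nat) \<Rightarrow> bool" where
  "same_sex_cond N k cnt \<longleftrightarrow>
     (\<forall>x<N. (x < k \<longrightarrow> (\<forall>y<N. y \<noteq> x \<longrightarrow> cnt x y = 1)) \<and>
            (k \<le> x \<longrightarrow> (\<exists>y. k \<le> y \<and> y < N \<and> y \<noteq> x \<and> cnt x y = 2 \<and>
                              (\<forall>z<N. z \<noteq> x \<and> z \<noteq> y \<longrightarrow> cnt x z = 1))))"

definition is_CMDRR :: "nat \<Rightarrow> nat \<Rightarrow> game list \<Rightarrow> bool" where
  "is_CMDRR N k G \<longleftrightarrow> k \<le> N \<and>
     (\<forall>g\<in>set G. valid_game N k g) \<and>
     (\<forall>m<N. \<forall>w<N. \<not> spouses k m w \<longrightarrow> partner_count G m w = 1 \<and> opp_count G m w = 1) \<and>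
     same_sex_cond N k (men_opp_count G) \<and>
     same_sex_cond N k (women_opp_count G)"

definition proper_round :: "game list \<Rightarrow> bool" where
  "proper_round r \<longleftrightarrow>
     distinct (concat (map (\<lambda>((a,b),(c,d)). [a,c]) r)) \<and>
     distinct (concat (map (\<lambda>((a,b),(c,d)). [b,d]) r))"

definition round_players :: "game list \<Rightarrow> (nat + nat) set" where
  "round_players r = (\<Union>g\<in>set r. case g of ((a,b),(c,d)) \<Rightarrow> {Inl a, Inr b, Inl c, Inr d})"

definition full_round :: "nat \<Rightarrow> game list \<Rightarrow> bool" where
  "full_round N r \<longleftrightarrow> card (round_players r) = (if even N then 2 * N else 2 * N - 2)"

definition full_resolution :: "nat \<Rightarrow> game list list \<Rightarrow> bool" where
  "full_resolution N R \<longleftrightarrow> (\<forall>r\<in>set R. proper_round r) \<and>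
     length (filter (\<lambda>r. \<not> full_round N r) R) \<le> 1"

definition fully_resolvable_CMDRR_exists :: "nat \<Rightarrow> nat \<Rightarrow> bool" where
  "fully_resolvable_CMDRR_exists N k \<longleftrightarrow>
     (\<exists>R. is_CMDRR N k (concat R) \<and> full_resolution N R)"

end

theory Submission
  imports Defs "HOL-Number_Theory.Cong"
begin

text \<open>A frame is a partial tournament in which the players are divided into holes: two players meet, in every one of
  the prescribed ways, exactly once if they lie in different holes and never otherwise, and there is one round for
  every point, involving exactly the points outside its hole. If all holes have size three, then putting the four
  games of a CMDRR(3, 1) into each hole gives a fully resolvable CMDRR: three of the games complete the rounds of the
  three points of the hole and the fourth goes to the short round.

  Frames with \<open>2 u + 1\<close> holes of size three exist for all \<open>u \<ge> 2\<close>. For small \<open>u\<close> they are developed from base games over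
  an abelian group. For large \<open>u\<close>, take a transversal design with eight groups of size \<open>m\<close>, truncate three of its groups
  so that \<open>u\<close> points remain, replace every point by six points and every block by a frame with 5, 6, 7 or 8 holes of size
  six, and fill each group, together with three common new points, with a smaller frame.\<close>

section \<open>Holey frames\<close>

text \<open>A frame is a holey self-orthogonal Latin square with a symmetric orthogonal mate: the
  woman \<open>b\<close> is the entry of the square at the men \<open>a\<close> and
  \<open>c\<close>, and the round is the entry of the mate. Hole size three fits the local
  tournament, in which the two unmarried men, and likewise the two unmarried women, oppose each
  other twice. Three facts shape the recursion. In a round the points outside a hole are paired off
  as opposing men, so with holes of size three the number of holes is odd. Blocks of a truncated
  design have even and odd sizes and cannot all carry weight three; the even weight six serves both.
  A group of \<open>s\<close> points then becomes \<open>2 s\<close> holes of size three, and the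
  common new points are one more hole, so the form \<open>2 u + 1\<close> passes from the group
  sizes to their sum. Finally, the five entries of a tuple lie in different holes. Hence blocks need
  at least five points, which is why five groups stay whole, and a group never keeps exactly one
  point, since it would need a frame with three holes.\<close>

definition swap5 :: "'a list \<Rightarrow> 'a list" where
  "swap5 t = [t ! 1, t ! 0, t ! 3, t ! 2, t ! 4]"

text \<open>A tuple \<open>[a, c, b, d, s]\<close> is the game of man \<open>a\<close> and woman \<open>b\<close> against man \<open>c\<close> and woman \<open>d\<close>
  in round \<open>s\<close>, so rounds are indexed by points as well. Naming the two teams in the other order is the swap.\<close>

definition hframe :: "'a set \<Rightarrow> ('a \<Rightarrow> 'h) \<Rightarrow> 'a list set \<Rightarrow> bool" where
  "hframe P hole Q \<longleftrightarrow> finite P \<and>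
     (\<forall>t\<in>Q. length t = 5 \<and> set t \<subseteq> P \<and> distinct (map hole t) \<and> swap5 t \<in> Q) \<and>
     (\<forall>i<5. \<forall>j<5. \<forall>p\<in>P. \<forall>q\<in>P. i \<noteq> j \<longrightarrow> hole p \<noteq> hole q \<longrightarrow>
        (\<exists>!t. t \<in> Q \<and> t ! i = p \<and> t ! j = q))"

definition uniform_frame :: "nat \<Rightarrow> nat \<Rightarrow> bool" where
  "uniform_frame h n \<longleftrightarrow> (\<exists>Q :: (nat \<times> nat) list set. hframe ({..<n} \<times> {..<h}) fst Q)"

lemma length5_cases:
  assumes "length t = 5"
  obtains a b c d e where "t = [a, b, c, d, e]"
proof -
  from assms obtain a b c d e where "t = [a, b, c, d, e]"
    by (auto simp: length_Suc_conv eval_nat_numeral)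
  then show thesis using that by blast
qed

lemma nat_less_5_cases: "(i :: nat) < 5 \<longleftrightarrow> i = 0 \<or> i = 1 \<or> i = 2 \<or> i = 3 \<or> i = 4"
  by auto

lemma length_swap5 [simp]: "length (swap5 t) = 5"
  by (simp add: swap5_def)

lemma swap5_swap5: "length t = 5 \<Longrightarrow> swap5 (swap5 t) = t"
  by (erule length5_cases) (simp add: swap5_def)

lemma map_swap5: "length t = 5 \<Longrightarrow> map f (swap5 t) = swap5 (map f t)"
  by (erule length5_cases) (simp add: swap5_def)

lemma hframeD:
  assumes "hframe P hole Q"
  shows "finite P" "t \<in> Q \<Longrightarrow> length t = 5" "t \<in> Q \<Longrightarrow> set t \<subseteq> P"
    "t \<in> Q \<Longrightarrow> distinct (map hole t)" "t \<in> Q \<Longrightarrow> swap5 t \<in> Q"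
  using assms unfolding hframe_def by blast+

lemma hframe_ex1:
  assumes "hframe P hole Q" "i < 5" "j < 5" "i \<noteq> j" "p \<in> P" "q \<in> P" "hole p \<noteq> hole q"
  shows "\<exists>!t. t \<in> Q \<and> t ! i = p \<and> t ! j = q"
  using assms unfolding hframe_def by blast

lemma hframe_nth_in:
  assumes "hframe P hole Q" "t \<in> Q" "i < 5"
  shows "t ! i \<in> P"
  using hframeD[OF assms(1)] assms(2,3) by (metis nth_mem subsetD)

lemma hframe_nth_hole_neq:
  assumes "hframe P hole Q" "t \<in> Q" "i < 5" "j < 5" "i \<noteq> j"
  shows "hole (t ! i) \<noteq> hole (t ! j)"
proof -
  have "length t = 5" "distinct (map hole t)"
    using hframeD[OF assms(1)] assms(2) by blast+
  then show ?thesis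
    using assms(3-5) by (metis length_map nth_eq_iff_index_eq nth_map)
qed

text \<open>Up to reversing the two columns and applying the swap, there are only six pairs of columns.\<close>

lemma hframeI:
  assumes fin: "finite P"
    and tup: "\<And>t. t \<in> Q \<Longrightarrow> length t = 5 \<and> set t \<subseteq> P \<and> distinct (map hole t) \<and> swap5 t \<in> Q"
    and ex1: "\<And>i j p q. (i, j) \<in> {(0, 1), (2, 3), (0, 2), (0, 3), (0, 4), (2, 4)} \<Longrightarrow>
       p \<in> P \<Longrightarrow> q \<in> P \<Longrightarrow> hole p \<noteq> hole q \<Longrightarrow> \<exists>!t. t \<in> Q \<and> t ! i = p \<and> t ! j = q"
  shows "hframe P hole Q"
proof -
  define ok where "ok i j \<longleftrightarrow> (\<forall>p\<in>P. \<forall>q\<in>P. hole p \<noteq> hole q \<longrightarrow>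
     (\<exists>!t. t \<in> Q \<and> t ! i = p \<and> t ! j = q))" for i j :: nat
  have base: "ok 0 1" "ok 2 3" "ok 0 2" "ok 0 3" "ok 0 4" "ok 2 4"
    unfolding ok_def by (intro ballI impI ex1; simp)+
  have sym: "ok j i" if "ok i j" for i j
  proof -
    have "(\<exists>!t. t \<in> Q \<and> t ! j = p \<and> t ! i = q)" if "p \<in> P" "q \<in> P" "hole p \<noteq> hole q" for p q
    proof -
      have "\<exists>!t. t \<in> Q \<and> t ! i = q \<and> t ! j = p"
        using \<open>ok i j\<close> that unfolding ok_def by metis
      then show ?thesis by (simp add: conj_commute)
    qed
    then show ?thesis unfolding ok_def by blast
  qed
  \<comment> \<open>The swap is an involution on \<open>Q\<close>, so it carries the unique tuple
    for one pair of columns to the unique tuple for the other pair.\<close>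
  have swap: "ok i' j'" if "ok i j" and "\<And>t. t \<in> Q \<Longrightarrow> swap5 t ! i = t ! i' \<and> swap5 t ! j = t ! j'"
    for i j i' j'
    unfolding ok_def
  proof (intro ballI impI)
    fix p q assume pq: "p \<in> P" "q \<in> P" "hole p \<noteq> hole q"
    obtain t where t: "t \<in> Q" "t ! i = p" "t ! j = q"
      and un: "\<And>t'. t' \<in> Q \<Longrightarrow> t' ! i = p \<Longrightarrow> t' ! j = q \<Longrightarrow> t' = t"
      using \<open>ok i j\<close> pq unfolding ok_def by metis
    have sw: "swap5 t \<in> Q" "swap5 (swap5 t) = t"
      using tup[OF t(1)] swap5_swap5 by auto
    show "\<exists>!t. t \<in> Q \<and> t ! i' = p \<and> t ! j' = q"
    proof (rule ex1I[of _ "swap5 t"])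
      show "swap5 t \<in> Q \<and> swap5 t ! i' = p \<and> swap5 t ! j' = q"
        using that(2)[OF sw(1)] sw t by auto
      fix s assume s: "s \<in> Q \<and> s ! i' = p \<and> s ! j' = q"
      then have "swap5 s = t"
        using un[of "swap5 s"] that(2)[of s] tup[of s] by auto
      then show "s = swap5 t"
        using tup[of s] s swap5_swap5[of s] by auto
    qed
  qed
  have more: "ok 1 3" "ok 1 2" "ok 1 4" "ok 3 4"
    by (rule swap[OF base(3)] swap[OF base(4)] swap[OF base(5)] swap[OF base(6)]; simp add: swap5_def)+
  have "ok i j" if "i < 5" "j < 5" "i \<noteq> j" for i j
    using that base more base[THEN sym] more[THEN sym] unfolding nat_less_5_cases
    by (elim disjE) (simp_all only: refl simp_thms)
  then show ?thesis
    unfolding hframe_def ok_def using fin tup by blast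
qed

section \<open>Relabelling the points of a frame\<close>

lemma hframe_image:
  assumes fr: "hframe P hole Q" and inj: "inj_on \<phi> P"
    and hole: "\<And>p q. p \<in> P \<Longrightarrow> q \<in> P \<Longrightarrow> hole' (\<phi> p) = hole' (\<phi> q) \<longleftrightarrow> hole p = hole q"
  shows "hframe (\<phi> ` P) hole' (map \<phi> ` Q)"
  unfolding hframe_def
proof (intro conjI ballI allI impI)
  show "finite (\<phi> ` P)" using hframeD(1)[OF fr] by simp
next
  fix t' assume "t' \<in> map \<phi> ` Q"
  then obtain t where t: "t \<in> Q" "t' = map \<phi> t" by blast
  note tD = hframeD[OF fr]
  have l: "length t = 5" and sub: "set t \<subseteq> P" and d: "distinct (map hole t)" and s: "swap5 t \<in> Q"
    using tD(2-5) t(1) by blast+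
  show "length t' = 5" using t l by simp
  show "set t' \<subseteq> \<phi> ` P" using t sub by auto
  show "distinct (map hole' t')"
    unfolding distinct_conv_nth
  proof (intro allI impI)
    fix i j assume ij: "i < length (map hole' t')" "j < length (map hole' t')" "i \<noteq> j"
    then have "hole (t ! i) \<noteq> hole (t ! j)" "t ! i \<in> P" "t ! j \<in> P"
      using hframe_nth_hole_neq[OF fr t(1)] hframe_nth_in[OF fr t(1)] t l by auto
    then show "map hole' t' ! i \<noteq> map hole' t' ! j"
      using hole ij t by auto
  qed
  show "swap5 t' \<in> map \<phi> ` Q"
    using s map_swap5[OF l, of \<phi>] t by force
next
  fix i j :: nat and p' q'
  assume ij: "i < 5" "j < 5" "i \<noteq> j" and "p' \<in> \<phi> ` P" "q' \<in> \<phi> ` P" and ne: "hole' p' \<noteq> hole' q'"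
  then obtain p q where pq: "p \<in> P" "q \<in> P" "p' = \<phi> p" "q' = \<phi> q" by blast
  have "hole p \<noteq> hole q" using hole pq ne by blast
  then obtain t where t: "t \<in> Q" "t ! i = p" "t ! j = q"
    and un: "\<And>t'. t' \<in> Q \<Longrightarrow> t' ! i = p \<Longrightarrow> t' ! j = q \<Longrightarrow> t' = t"
    using hframe_ex1[OF fr ij pq(1,2)] by metis
  show "\<exists>!t. t \<in> map \<phi> ` Q \<and> t ! i = p' \<and> t ! j = q'"
  proof (rule ex1I[of _ "map \<phi> t"])
    show "map \<phi> t \<in> map \<phi> ` Q \<and> map \<phi> t ! i = p' \<and> map \<phi> t ! j = q'"
      using t pq ij hframeD(2)[OF fr] by auto
    fix s' assume s': "s' \<in> map \<phi> ` Q \<and> s' ! i = p' \<and> s' ! j = q'"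
    then obtain s where s: "s \<in> Q" "s' = map \<phi> s" by blast
    have "\<phi> (s ! i) = \<phi> p" "\<phi> (s ! j) = \<phi> q"
      using s' s pq ij hframeD(2)[OF fr s(1)] by auto
    then have "s ! i = p" "s ! j = q"
      using inj pq hframe_nth_in[OF fr s(1)] ij by (auto dest: inj_onD)
    then show "s' = map \<phi> t" using un s by blast
  qed
qed

lemma card_eq_classes:
  assumes "finite P" "\<And>p. p \<in> P \<Longrightarrow> card {q \<in> P. hole q = hole p} = h"
  shows "card P = card (hole ` P) * h"
proof -
  have "card P = (\<Sum>c\<in>hole ` P. card {q \<in> P. hole q = c})"
    using sum.image_gen[OF assms(1), of "\<lambda>_. 1 :: nat" hole] by simp
  also have "\<dots> = (\<Sum>c\<in>hole ` P. h)"
    by (rule sum.cong) (use assms(2) in auto)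
  finally show ?thesis by simp
qed

text \<open>Numbering the holes, and then the points inside each hole, maps any frame with holes of
  equal size to the standard carrier. Since \<open>h > 0\<close>, the total size determines the
  number of holes.\<close>

lemma uniform_frameI:
  assumes fr: "hframe P hole Q" and h: "h > 0"
    and cls: "\<And>p. p \<in> P \<Longrightarrow> card {q \<in> P. hole q = hole p} = h"
    and card: "card P = n * h"
  shows "uniform_frame h n"
proof -
  have fin: "finite P" using hframeD(1)[OF fr] .
  have n: "card (hole ` P) = n"
    using card_eq_classes[OF fin cls] card h by simp
  obtain \<beta> where \<beta>: "bij_betw \<beta> (hole ` P) {..<n}"
    using n fin by (metis card_lessThan finite_imageI finite_lessThan finite_same_card_bij)
  have "\<exists>g. bij_betw g {q \<in> P. hole q = c} {..<h}" if "c \<in> hole ` P" for c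
  proof (rule finite_same_card_bij)
    show "card {q \<in> P. hole q = c} = card {..<h}" using that cls by auto
  qed (use fin in auto)
  then obtain \<gamma> where \<gamma>: "\<And>c. c \<in> hole ` P \<Longrightarrow> bij_betw (\<gamma> c) {q \<in> P. hole q = c} {..<h}"
    by metis
  define \<phi> where "\<phi> p = (\<beta> (hole p), \<gamma> (hole p) p)" for p
  have inj: "inj_on \<phi> P"
  proof (rule inj_onI)
    fix p q assume pq: "p \<in> P" "q \<in> P" "\<phi> p = \<phi> q"
    then have "hole p = hole q"
      using \<beta> by (auto simp: \<phi>_def bij_betw_def dest: inj_onD)
    then show "p = q"
      using pq \<gamma>[of "hole p"] by (auto simp: \<phi>_def bij_betw_def dest!: inj_onD)
  qed
  have "\<phi> ` P \<subseteq> {..<n} \<times> {..<h}"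
    using \<beta> \<gamma> by (auto simp: \<phi>_def bij_betw_def)
  moreover have "card (\<phi> ` P) = card ({..<n} \<times> {..<h})"
    using card_image[OF inj] card by (simp add: card_cartesian_product)
  ultimately have im: "\<phi> ` P = {..<n} \<times> {..<h}"
    by (simp add: card_subset_eq)
  have "hframe (\<phi> ` P) fst (map \<phi> ` Q)"
    by (rule hframe_image[OF fr inj]) (use \<beta> in \<open>auto simp: \<phi>_def bij_betw_def dest: inj_onD\<close>)
  then show ?thesis unfolding uniform_frame_def im by blast
qed

lemma uniform_frame_on:
  assumes "uniform_frame h k" "finite B" "card B = k"
  shows "\<exists>Q. hframe (B \<times> {..<h}) fst Q"
proof -
  obtain Q :: "(nat \<times> nat) list set" where Q: "hframe ({..<k} \<times> {..<h}) fst Q"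
    using assms(1) unfolding uniform_frame_def by blast
  obtain g where g: "bij_betw g {..<k} B"
    using assms(2,3) by (metis card_lessThan finite_lessThan finite_same_card_bij)
  have im: "(\<lambda>p. (g (fst p), snd p)) ` ({..<k} \<times> {..<h}) = B \<times> {..<h}"
    using map_prod_surj_on[of g "{..<k}" B id "{..<h}" "{..<h}"] g
    by (simp add: bij_betw_def map_prod_def split_beta)
  have "hframe ((\<lambda>p. (g (fst p), snd p)) ` ({..<k} \<times> {..<h})) fst (map (\<lambda>p. (g (fst p), snd p)) ` Q)"
    by (rule hframe_image[OF Q]) (use g in \<open>auto simp: bij_betw_def inj_on_def\<close>)
  then show ?thesis unfolding im by blast
qed

text \<open>Wilson's fundamental construction with constant weight \<open>h\<close>. Two elements of
  \<open>V\<close> in different groups lie in one common block, and only the frame of that block can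
  contain points over both. Distinct elements of one group share no block, because
  \<open>grp\<close> is injective on blocks, and points over the same element share a hole of every
  block frame. So the groups become the holes.\<close>

lemma frame_from_blocks:
  assumes "finite V"
    and blk: "\<And>B. B \<in> \<B> \<Longrightarrow> B \<subseteq> V \<and> inj_on grp B \<and> uniform_frame h (card B)"
    and ex1: "\<And>x y. x \<in> V \<Longrightarrow> y \<in> V \<Longrightarrow> grp x \<noteq> grp y \<Longrightarrow> \<exists>!B. B \<in> \<B> \<and> x \<in> B \<and> y \<in> B"
  shows "\<exists>Q. hframe (V \<times> {..<h}) (\<lambda>p. grp (fst p)) Q"
proof -
  have "\<exists>Q. hframe (B \<times> {..<h}) fst Q" if "B \<in> \<B>" for B
    using uniform_frame_on blk[OF that] \<open>finite V\<close> by (metis finite_subset)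
  then obtain Q where Q: "\<And>B. B \<in> \<B> \<Longrightarrow> hframe (B \<times> {..<h}) fst (Q B)" by metis
  have "hframe (V \<times> {..<h}) (\<lambda>p. grp (fst p)) (\<Union>B\<in>\<B>. Q B)"
    unfolding hframe_def
  proof (intro conjI ballI allI impI)
    show "finite (V \<times> {..<h})" using \<open>finite V\<close> by simp
  next
    fix t assume "t \<in> (\<Union>B\<in>\<B>. Q B)"
    then obtain B where B: "B \<in> \<B>" "t \<in> Q B" by blast
    note D = hframeD[OF Q[OF B(1)]]
    show "length t = 5" using D(2) B by blast
    show "set t \<subseteq> V \<times> {..<h}" using D(3) B blk[OF B(1)] by blast
    have "map (\<lambda>p. grp (fst p)) t = map grp (map fst t)" by simp
    moreover have "distinct (map fst t)" using D(4) B by blast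
    moreover have "set (map fst t) \<subseteq> B" using D(3) B by force
    ultimately show "distinct (map (\<lambda>p. grp (fst p)) t)"
      using blk[OF B(1)] by (metis distinct_map inj_on_subset)
    show "swap5 t \<in> (\<Union>B\<in>\<B>. Q B)" using D(5) B by blast
  next
    fix i j :: nat and p q
    assume ij: "i < 5" "j < 5" "i \<noteq> j" and pq: "p \<in> V \<times> {..<h}" "q \<in> V \<times> {..<h}"
      and ne: "grp (fst p) \<noteq> grp (fst q)"
    obtain B where B: "B \<in> \<B>" "fst p \<in> B" "fst q \<in> B"
      and un: "\<And>B'. B' \<in> \<B> \<Longrightarrow> fst p \<in> B' \<Longrightarrow> fst q \<in> B' \<Longrightarrow> B' = B"
      using ex1[of "fst p" "fst q"] pq ne by (metis mem_Times_iff)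
    have pqB: "p \<in> B \<times> {..<h}" "q \<in> B \<times> {..<h}" using pq B by (auto simp: mem_Times_iff)
    have "\<exists>!t. t \<in> Q B \<and> t ! i = p \<and> t ! j = q"
      using hframe_ex1[OF Q[OF B(1)] ij pqB] ne by metis
    moreover have "t \<in> (\<Union>B\<in>\<B>. Q B) \<and> t ! i = p \<and> t ! j = q \<longleftrightarrow> t \<in> Q B \<and> t ! i = p \<and> t ! j = q" for t
    proof -
      \<comment> \<open>The entries of a tuple of \<open>Q B'\<close> lie over \<open>B'\<close>, so
        \<open>B'\<close> contains both \<open>fst p\<close> and \<open>fst q\<close>.\<close>
      have "B' = B" if "B' \<in> \<B>" "t \<in> Q B'" "t ! i = p" "t ! j = q" for B'
        using un[OF that(1)] hframe_nth_in[OF Q[OF that(1)] that(2)] that ij by force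
      then show ?thesis using B(1) by blast
    qed
    ultimately show "\<exists>!t. t \<in> (\<Union>B\<in>\<B>. Q B) \<and> t ! i = p \<and> t ! j = q" by presburger
  qed
  then show ?thesis by blast
qed

text \<open>The new points form one and the same hole, labelled \<open>z\<close>, in every inserted
  frame. Hence pairs inside \<open>Y\<close> occur nowhere, and the inserted frames, whose point
  sets meet only in \<open>Y\<close>, never cover a pair twice. In the result, \<open>None\<close>
  names the hole \<open>Y\<close>, and an old hole together with a hole of its inserted frame names
  each of the others.\<close>

lemma fill_holes:
  assumes fr: "hframe P hole Q" and Y: "finite Y" "P \<inter> Y = {}"
    and sub: "\<And>c. c \<in> hole ` P \<Longrightarrow> hframe ({p \<in> P. hole p = c} \<union> Y) (sub c) (R c)"
    and subY: "\<And>c y. c \<in> hole ` P \<Longrightarrow> y \<in> Y \<Longrightarrow> sub c y = z"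
    and subP: "\<And>p. p \<in> P \<Longrightarrow> sub (hole p) p \<noteq> z"
  shows "hframe (P \<union> Y) (\<lambda>p. if p \<in> Y then None else Some (hole p, sub (hole p) p))
    (Q \<union> (\<Union>c\<in>hole ` P. R c))"
    (is "hframe _ ?h ?Q")
proof -
  have hP: "?h p = Some (hole p, sub (hole p) p)" if "p \<in> P" for p using Y that by auto
  have hc: "?h p = ?h q \<longleftrightarrow> sub c p = sub c q"
    if "c \<in> hole ` P" "p \<in> {p \<in> P. hole p = c} \<union> Y" "q \<in> {p \<in> P. hole p = c} \<union> Y" for c p q
  proof -
    have "p \<in> Y \<or> (p \<notin> Y \<and> hole p = c \<and> sub c p \<noteq> z)"
      using that(2) subP[of p] Y(2) by blast
    moreover have "q \<in> Y \<or> (q \<notin> Y \<and> hole q = c \<and> sub c q \<noteq> z)"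
      using that(3) subP[of q] Y(2) by blast
    moreover have "p \<in> Y \<Longrightarrow> sub c p = z" "q \<in> Y \<Longrightarrow> sub c q = z"
      using subY[OF that(1)] by blast+
    ultimately show ?thesis by (elim disjE conjE) simp_all
  qed
  show ?thesis
    unfolding hframe_def
  proof (intro conjI ballI allI impI)
    show "finite (P \<union> Y)" using hframeD(1)[OF fr] Y by simp
  next
    fix t assume "t \<in> ?Q"
    then consider "t \<in> Q" | c where "c \<in> hole ` P" "t \<in> R c" by blast
    then have "length t = 5 \<and> set t \<subseteq> P \<union> Y \<and> distinct (map ?h t) \<and> swap5 t \<in> ?Q"
    proof cases
      case 1
      note D = hframeD(2-5)[OF fr 1]
      have "distinct (map ?h t)"
        unfolding distinct_conv_nth
      proof (intro allI impI)
        fix i j assume ij: "i < length (map ?h t)" "j < length (map ?h t)" "i \<noteq> j"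
        then have "hole (t ! i) \<noteq> hole (t ! j)" "t ! i \<in> P" "t ! j \<in> P"
          using hframe_nth_hole_neq[OF fr 1] hframe_nth_in[OF fr 1] D by auto
        then show "map ?h t ! i \<noteq> map ?h t ! j" using ij hP by auto
      qed
      then show ?thesis using D by auto
    next
      case 2
      note D = hframeD(2-5)[OF sub[OF 2(1)] 2(2)]
      have "distinct (map ?h t)"
        unfolding distinct_conv_nth
      proof (intro allI impI)
        fix i j assume ij: "i < length (map ?h t)" "j < length (map ?h t)" "i \<noteq> j"
        then have "sub c (t ! i) \<noteq> sub c (t ! j)" "t ! i \<in> {p \<in> P. hole p = c} \<union> Y" "t ! j \<in> {p \<in> P. hole p = c} \<union> Y"
          using hframe_nth_hole_neq[OF sub[OF 2(1)] 2(2)] hframe_nth_in[OF sub[OF 2(1)] 2(2)] D by auto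
        then show "map ?h t ! i \<noteq> map ?h t ! j" using ij hc[OF 2(1), of "t ! i" "t ! j"] by auto
      qed
      then show ?thesis using D 2 by auto
    qed
    then show "length t = 5" "set t \<subseteq> P \<union> Y" "distinct (map ?h t)" "swap5 t \<in> ?Q" by auto
  next
    fix i j :: nat and p q
    assume ij: "i < 5" "j < 5" "i \<noteq> j" and pq: "p \<in> P \<union> Y" "q \<in> P \<union> Y" and ne: "?h p \<noteq> ?h q"
    show "\<exists>!t. t \<in> ?Q \<and> t ! i = p \<and> t ! j = q"
    proof (cases "p \<in> P \<and> q \<in> P \<and> hole p \<noteq> hole q")
      case True
      have "\<exists>!t. t \<in> Q \<and> t ! i = p \<and> t ! j = q" using hframe_ex1[OF fr ij] True by blast
      moreover have "\<not> (t \<in> R c \<and> t ! i = p \<and> t ! j = q)" if "c \<in> hole ` P" for t c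
        using hframe_nth_in[OF sub[OF that]] ij True Y by blast
      ultimately show ?thesis by blast
    next
      case False
      \<comment> \<open>Points of \<open>Y\<close> share a hole, so at least one of \<open>p\<close>
        and \<open>q\<close> lies in \<open>P\<close>; its old hole is \<open>c\<close>.\<close>
      then obtain c where c: "c \<in> hole ` P" "p \<in> {p \<in> P. hole p = c} \<union> Y" "q \<in> {p \<in> P. hole p = c} \<union> Y"
        using pq ne by (cases "p \<in> P"; cases "q \<in> P") (auto split: if_splits)
      have R1: "\<exists>!t. t \<in> R c \<and> t ! i = p \<and> t ! j = q"
        using hframe_ex1[OF sub[OF c(1)] ij c(2,3)] hc[OF c] ne by blast
      have notQ: "\<not> (t \<in> Q \<and> t ! i = p \<and> t ! j = q)" for t
        using hframe_nth_in[OF fr, of t] hframe_nth_hole_neq[OF fr, of t i j] ij False by blast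
      have cc: "c' = c" if "c' \<in> hole ` P" "t \<in> R c'" "t ! i = p" "t ! j = q" for t c'
      proof -
        have "p \<in> {p \<in> P. hole p = c'} \<union> Y" "q \<in> {p \<in> P. hole p = c'} \<union> Y"
          using hframe_nth_in[OF sub[OF that(1)] that(2)] ij that by blast+
        moreover have "\<not> (p \<in> Y \<and> q \<in> Y)" using ne by auto
        ultimately show ?thesis using c Y by blast
      qed
      have "t \<in> ?Q \<and> t ! i = p \<and> t ! j = q \<longleftrightarrow> t \<in> R c \<and> t ! i = p \<and> t ! j = q" for t
      proof
        assume t: "t \<in> ?Q \<and> t ! i = p \<and> t ! j = q"
        then obtain c' where "c' \<in> hole ` P" "t \<in> R c'" using notQ[of t] by auto
        then show "t \<in> R c \<and> t ! i = p \<and> t ! j = q" using cc[of c' t] t by simp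
      qed (use c(1) in auto)
      then show ?thesis using R1 by presburger
    qed
  qed
qed

text \<open>This supplies the inserted frames for \<open>fill_holes\<close>: hole 0 of the standard
  frame is laid on the prescribed new points \<open>Y\<close>, so that 0 is the common label
  \<open>z\<close>, and the other \<open>k\<close> holes are laid on \<open>A\<close>.\<close>

lemma uniform_frame_pointed:
  assumes uf: "uniform_frame h (Suc k)" and fin: "finite A" "finite Y" and card: "card A = k * h" "card Y = h"
    and disj: "A \<inter> Y = {}"
  shows "\<exists>(sub :: 'a \<Rightarrow> nat) R. hframe (A \<union> Y) sub R \<and> (\<forall>y\<in>Y. sub y = 0) \<and> (\<forall>a\<in>A. sub a \<noteq> 0) \<and>
    (\<forall>a\<in>A. card {b \<in> A. sub b = sub a} = h)"
proof -
  obtain Q :: "(nat \<times> nat) list set" where Q: "hframe ({..<Suc k} \<times> {..<h}) fst Q"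
    using uf unfolding uniform_frame_def by blast
  have "card ({1..k} \<times> {..<h}) = card A" using card by simp
  then obtain f where f: "bij_betw f ({1..k} \<times> {..<h}) A"
    using fin by (metis finite_SigmaI finite_atLeastAtMost finite_lessThan finite_same_card_bij)
  have "card ({0 :: nat} \<times> {..<h}) = card Y" using card by simp
  then obtain g where g: "bij_betw g ({0 :: nat} \<times> {..<h}) Y"
    using fin by (metis finite_SigmaI finite_lessThan finite_same_card_bij finite.emptyI finite.insertI)
  define \<phi> where "\<phi> p = (if fst p = 0 then g p else f p)" for p :: "nat \<times> nat"
  have un: "{..<Suc k} \<times> {..<h} = ({0} \<times> {..<h}) \<union> ({1..k} \<times> {..<h})" by auto
  have b0: "bij_betw \<phi> ({0} \<times> {..<h}) Y"
    using g by (subst bij_betw_cong[of _ _ g]) (auto simp: \<phi>_def)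
  have b1: "bij_betw \<phi> ({1..k} \<times> {..<h}) A"
    using f by (subst bij_betw_cong[of _ _ f]) (auto simp: \<phi>_def)
  have bij: "bij_betw \<phi> ({..<Suc k} \<times> {..<h}) (A \<union> Y)"
    using bij_betw_combine[OF b1 b0 disj] un by (simp add: Un_commute)
  define \<psi> where "\<psi> = inv_into ({..<Suc k} \<times> {..<h}) \<phi>"
  have \<psi>: "\<psi> (\<phi> p) = p" if "p \<in> {..<Suc k} \<times> {..<h}" for p
    using bij that unfolding \<psi>_def bij_betw_def by simp
  have im: "\<phi> ` ({..<Suc k} \<times> {..<h}) = A \<union> Y" using bij by (simp add: bij_betw_def)
  have "hframe (\<phi> ` ({..<Suc k} \<times> {..<h})) (\<lambda>p. fst (\<psi> p)) (map \<phi> ` Q)"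
    by (rule hframe_image[OF Q]) (use bij \<psi> in \<open>auto simp: bij_betw_def\<close>)
  then have fr: "hframe (A \<union> Y) (\<lambda>p. fst (\<psi> p)) (map \<phi> ` Q)" unfolding im .
  have Y0: "fst (\<psi> y) = 0" if y: "y \<in> Y" for y
  proof -
    obtain p where "p \<in> {0} \<times> {..<h}" "y = \<phi> p" using b0 y by (metis bij_betw_imp_surj_on imageE)
    then show ?thesis using \<psi>[of p] by auto
  qed
  have A0: "\<exists>i j. i \<in> {1..k} \<and> j < h \<and> a = \<phi> (i, j) \<and> \<psi> a = (i, j)" if a: "a \<in> A" for a
  proof -
    obtain p where "p \<in> {1..k} \<times> {..<h}" "a = \<phi> p" using b1 a by (metis bij_betw_imp_surj_on imageE)
    then show ?thesis using \<psi>[of p] by (cases p) auto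
  qed
  have A1: "fst (\<psi> a) \<noteq> 0" if "a \<in> A" for a
    using A0[OF that] by auto
  have cl: "card {b \<in> A. fst (\<psi> b) = fst (\<psi> a)} = h" if a: "a \<in> A" for a
  proof -
    obtain i j where i: "i \<in> {1..k}" "\<psi> a = (i, j)" using A0[OF a] by blast
    have "{b \<in> A. fst (\<psi> b) = i} = \<phi> ` ({i} \<times> {..<h})" (is "?L = ?R")
    proof
      show "?L \<subseteq> ?R"
      proof
        fix b assume "b \<in> ?L"
        moreover from this obtain i' j' where "j' < h" "b = \<phi> (i', j')" "\<psi> b = (i', j')" using A0[of b] by blast
        ultimately show "b \<in> ?R" by auto
      qed
      show "?R \<subseteq> ?L"
      proof
        fix b assume "b \<in> ?R"
        then obtain j where j: "j < h" "b = \<phi> (i, j)" by auto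
        then have "b \<in> A" using b1 i by (auto simp: bij_betw_def)
        then show "b \<in> ?L" using \<psi>[of "(i, j)"] i j by auto
      qed
    qed
    moreover have "inj_on \<phi> ({i} \<times> {..<h})"
      by (rule inj_on_subset[of \<phi> "{1..k} \<times> {..<h}"]) (use b1 i in \<open>auto simp: bij_betw_def\<close>)
    ultimately show ?thesis using i by (simp add: card_image)
  qed
  show ?thesis
    using fr Y0 A1 cl by (intro exI[of _ "\<lambda>p. fst (\<psi> p)"] exI[of _ "map \<phi> ` Q"] conjI ballI)
qed

section \<open>Truncated transversal designs\<close>

lemma dvd_diff_lt_imp_eq:
  fixes x y m :: int
  assumes "m dvd x - y" "0 \<le> x" "x < m" "0 \<le> y" "y < m"
  shows "x = y"
  using assms by (metis mod_eq_dvd_iff mod_pos_pos_trivial)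

text \<open>The blocks are the graphs of the lines $j \mapsto x + j y$ over the integers modulo $m$, with the slope $y$ recorded in group $k$,
  restricted to the first \<open>sz j\<close> points of each group $j$.\<close>

lemma truncated_td_ex1:
  fixes m :: int and k :: nat and sz :: "nat \<Rightarrow> nat"
  assumes m: "m > 0" and sz: "\<And>j. j \<le> k \<Longrightarrow> int (sz j) \<le> m"
    and cop: "\<And>d. 0 < d \<Longrightarrow> d < int k \<Longrightarrow> coprime d m"
    and V: "V = {(j, a). j \<le> k \<and> 0 \<le> a \<and> a < int (sz j)}"
    and blk: "blk = (\<lambda>(x, y). {(j, a) \<in> V. a = (if j = k then y else (x + int j * y) mod m)})"
    and p: "(j1, a1) \<in> V" and q: "(j2, a2) \<in> V" and ne: "j1 \<noteq> j2"
  shows "\<exists>!B. B \<in> blk ` ({0..<m} \<times> {0..<m}) \<and> (j1, a1) \<in> B \<and> (j2, a2) \<in> B"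
  using p q ne
proof (induction j1 j2 arbitrary: a1 a2 rule: linorder_wlog)
  case (sym j1 j2)
  then show ?case by (metis (no_types, lifting))
next
  case (le j1 j2)
  have lt: "j1 < j2" "j2 \<le> k" using le V by auto
  have a: "0 \<le> a1" "a1 < m" "0 \<le> a2" "a2 < m"
    using le V sz[of j1] sz[of j2] by auto
  have mem: "(j, a) \<in> blk (x, y) \<longleftrightarrow> (j, a) \<in> V \<and> a = (if j = k then y else (x + int j * y) mod m)" for j a x y
    using blk by auto
  show ?case
  proof (cases "j2 = k")
    \<comment> \<open>As \<open>j1 < j2\<close>, only \<open>j2\<close> can be the group that
      records the slope. The second point then gives \<open>y\<close>, and the first one determines
      \<open>x\<close>.\<close>
    case True
    show ?thesis
    proof (rule ex1I[of _ "blk ((a1 - int j1 * a2) mod m, a2)"])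
      show "blk ((a1 - int j1 * a2) mod m, a2) \<in> blk ` ({0..<m} \<times> {0..<m}) \<and>
        (j1, a1) \<in> blk ((a1 - int j1 * a2) mod m, a2) \<and> (j2, a2) \<in> blk ((a1 - int j1 * a2) mod m, a2)"
        using le lt True m a by (auto simp: mem mod_simps)
    next
      fix B assume "B \<in> blk ` ({0..<m} \<times> {0..<m}) \<and> (j1, a1) \<in> B \<and> (j2, a2) \<in> B"
      then obtain x y where xy: "B = blk (x, y)" "0 \<le> x" "x < m" "(j1, a1) \<in> blk (x, y)" "(j2, a2) \<in> blk (x, y)"
        by auto
      then have y: "y = a2" and "a1 = (x + int j1 * y) mod m" using True lt by (auto simp: mem)
      then have "(a1 - int j1 * a2) mod m = x mod m" by (simp add: mod_simps)
      then show "B = blk ((a1 - int j1 * a2) mod m, a2)" using xy y by simp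
    qed
  next
    case False
    \<comment> \<open>Subtracting the two line equations leaves \<open>d * y = a2 - a1\<close>
      modulo \<open>m\<close>, solved by the inverse \<open>e\<close> of \<open>d\<close>. Both
      indices are below \<open>k\<close> here, so \<open>d < k\<close> and \<open>cop\<close>
      applies.\<close>
    define d where "d = int j2 - int j1"
    have "coprime d m" using lt False cop[of d] by (auto simp: d_def)
    then obtain e where e: "[d * e = 1] (mod m)" using cong_solve_coprime_int by blast
    define y0 where "y0 = (e * (a2 - a1)) mod m"
    define x0 where "x0 = (a1 - int j1 * y0) mod m"
    have r: "0 \<le> y0" "y0 < m" "0 \<le> x0" "x0 < m" using m by (auto simp: y0_def x0_def)
    have "[d * y0 = (d * e) * (a2 - a1)] (mod m)"
      unfolding y0_def by (simp add: cong_def mod_simps mult.assoc)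
    also have "[(d * e) * (a2 - a1) = 1 * (a2 - a1)] (mod m)"
      using e by (rule cong_scalar_right)
    finally have dy: "[d * y0 = a2 - a1] (mod m)" by simp
    have e1: "(x0 + int j1 * y0) mod m = a1"
      using a unfolding x0_def by (simp add: mod_simps)
    have "(x0 + int j2 * y0) mod m = (x0 + int j1 * y0 + d * y0) mod m"
      by (simp add: d_def algebra_simps)
    also have "\<dots> = (a1 + (a2 - a1)) mod m"
      using e1 dy a by (metis cong_def mod_add_cong mod_mod_trivial)
    finally have e2: "(x0 + int j2 * y0) mod m = a2" using a by simp
    show ?thesis
    proof (rule ex1I[of _ "blk (x0, y0)"])
      show "blk (x0, y0) \<in> blk ` ({0..<m} \<times> {0..<m}) \<and> (j1, a1) \<in> blk (x0, y0) \<and> (j2, a2) \<in> blk (x0, y0)"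
        using r e1 e2 le lt False by (auto simp: mem)
    next
      fix B assume "B \<in> blk ` ({0..<m} \<times> {0..<m}) \<and> (j1, a1) \<in> B \<and> (j2, a2) \<in> B"
      then obtain x y where xy: "B = blk (x, y)" "0 \<le> x" "x < m" "0 \<le> y" "y < m"
          "(j1, a1) \<in> blk (x, y)" "(j2, a2) \<in> blk (x, y)"
        by auto
      then have a1: "a1 = (x + int j1 * y) mod m" and a2: "a2 = (x + int j2 * y) mod m"
        using False lt by (auto simp: mem)
      have "m dvd (x + int j1 * y) - (x0 + int j1 * y0)"
        using a1 e1 by (metis mod_eq_dvd_iff)
      moreover have "m dvd (x + int j2 * y) - (x0 + int j2 * y0)"
        using a2 e2 by (metis mod_eq_dvd_iff)
      ultimately have "m dvd ((x + int j2 * y) - (x0 + int j2 * y0)) - ((x + int j1 * y) - (x0 + int j1 * y0))"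
        by (rule dvd_diff[rotated])
      then have "m dvd d * (y - y0)" by (simp add: d_def algebra_simps)
      then have "m dvd y - y0"
        using \<open>coprime d m\<close> by (simp add: coprime_commute coprime_dvd_mult_right_iff)
      then have y: "y = y0" using dvd_diff_lt_imp_eq xy r by blast
      then have "m dvd x - x0"
        using \<open>m dvd (x + int j1 * y) - (x0 + int j1 * y0)\<close> by simp
      then have "x = x0" using dvd_diff_lt_imp_eq xy r by blast
      then show "B = blk (x0, y0)" using xy y by simp
    qed
  qed
qed

text \<open>A group of \<open>s\<close> points carries \<open>6 s\<close> points, which together
  with the three points of \<open>Y\<close> are filled by a frame with \<open>2 s + 1\<close> holes
  of size three, one of them being \<open>Y\<close>. As \<open>Y\<close> is shared by all groups,
  the numbers \<open>2 s\<close> add up and \<open>Y\<close> is counted once. An empty group leaves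
  no hole to fill, hence the condition \<open>sz j > 0\<close>.\<close>

lemma frame_recursion:
  fixes m k :: nat and sz :: "nat \<Rightarrow> nat"
  assumes m: "m > 0" and k: "4 \<le> k" and sz: "\<And>j. j \<le> k \<Longrightarrow> sz j \<le> m" and full: "\<And>j. j < 5 \<Longrightarrow> sz j = m"
    and cop: "\<And>d. 0 < d \<Longrightarrow> d < k \<Longrightarrow> coprime d m"
    and six: "\<And>c. 5 \<le> c \<Longrightarrow> c \<le> Suc k \<Longrightarrow> uniform_frame 6 c"
    and three: "\<And>j. j \<le> k \<Longrightarrow> sz j > 0 \<Longrightarrow> uniform_frame 3 (2 * sz j + 1)"
  shows "uniform_frame 3 (2 * (\<Sum>j\<le>k. sz j) + 1)"
proof -
  define V where "V = {(j, a :: int). j \<le> k \<and> 0 \<le> a \<and> a < int (sz j)}"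
  define blk where "blk = (\<lambda>(x, y). {(j, a) \<in> V. a = (if j = k then y else (x + int j * y) mod int m)})"
  define \<B> where "\<B> = blk ` ({0..<int m} \<times> {0..<int m})"
  have Veq: "V = (SIGMA j:{..k}. {0..<int (sz j)})" unfolding V_def by auto
  have finV: "finite V" unfolding Veq by auto
  have cardV: "card V = (\<Sum>j\<le>k. sz j)" unfolding Veq by simp
  have ex1: "\<exists>!B. B \<in> \<B> \<and> p \<in> B \<and> q \<in> B" if "p \<in> V" "q \<in> V" "fst p \<noteq> fst q" for p q
  proof -
    have "coprime d (int m)" if "0 < d" "d < int k" for d
      using cop[of "nat d"] that by (simp add: coprime_int_iff[symmetric] del: coprime_int_iff)
    then have "\<exists>!B. B \<in> blk ` ({0..<int m} \<times> {0..<int m}) \<and> (fst p, snd p) \<in> B \<and> (fst q, snd q) \<in> B"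
      using that m sz by (intro truncated_td_ex1[where V = V and k = k and sz = sz]) (auto simp: V_def blk_def)
    then show ?thesis unfolding \<B>_def by simp
  qed
  have blocks: "B \<subseteq> V \<and> inj_on fst B \<and> uniform_frame 6 (card B)" if BB: "B \<in> \<B>" for B
  proof -
    obtain x y where xy: "B = blk (x, y)" "0 \<le> y" "y < int m" using BB unfolding \<B>_def by auto
    have sub: "B \<subseteq> V" and inj: "inj_on fst B"
      unfolding xy blk_def by (auto simp: inj_on_def)
    have "fst ` B \<subseteq> {..k}" using sub V_def by auto
    then have "card B \<le> Suc k"
      using card_image[OF inj] card_mono[of "{..k}" "fst ` B"] by simp
    \<comment> \<open>Groups 0 to 4 are whole, so truncation deletes no point of a line there. If
      \<open>k = 4\<close>, the last of them records the slope, which is below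
      \<open>m\<close>.\<close>
    moreover have "{..<5} \<subseteq> fst ` B"
    proof
      fix j :: nat assume "j \<in> {..<5}"
      then have "(j, if j = k then y else (x + int j * y) mod int m) \<in> B"
        using full[of j] k m xy unfolding xy blk_def V_def by auto
      then show "j \<in> fst ` B" by force
    qed
    then have "5 \<le> card B"
      using card_image[OF inj] card_mono[of "fst ` B" "{..<5}"] sub finV by (simp add: finite_subset)
    ultimately show ?thesis using sub inj six by blast
  qed
  have "\<exists>Q. hframe (V \<times> {..<6 :: nat}) (\<lambda>p. fst (fst p)) Q"
    by (rule frame_from_blocks[OF finV blocks ex1])
  then obtain Q where Q: "hframe (V \<times> {..<6 :: nat}) (\<lambda>p. fst (fst p)) Q" ..
  define P where "P = V \<times> {..<6 :: nat}"
  define hole where "hole = (\<lambda>p :: (nat \<times> int) \<times> nat. fst (fst p))"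
  \<comment> \<open>The index \<open>Suc k\<close> belongs to no group, which keeps the three new
    points outside \<open>P\<close>.\<close>
  define Y where "Y = {(Suc k, 0 :: int)} \<times> {..<3 :: nat}"
  have fr: "hframe P hole Q" using Q unfolding P_def hole_def .
  have finP: "finite P" and finY: "finite Y" and disj: "P \<inter> Y = {}"
    using finV unfolding P_def Y_def V_def by auto
  have cardA: "card {p \<in> P. hole p = c} = 6 * sz c" if "c \<le> k" for c
  proof -
    have "{p \<in> P. hole p = c} = ({c} \<times> {0..<int (sz c)}) \<times> {..<6}"
      using that unfolding P_def hole_def V_def by auto
    then show ?thesis by simp
  qed
  define good where "good c sub R \<longleftrightarrow> hframe ({p \<in> P. hole p = c} \<union> Y) sub R \<and> (\<forall>y\<in>Y. sub y = 0) \<and>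
      (\<forall>a\<in>{p \<in> P. hole p = c}. sub a \<noteq> 0) \<and>
      (\<forall>a\<in>{p \<in> P. hole p = c}. card {b \<in> {p \<in> P. hole p = c}. sub b = sub a} = 3)"
    for c and sub :: "(nat \<times> int) \<times> nat \<Rightarrow> nat" and R
  have "\<exists>sub R. good c sub R" if c: "c \<in> hole ` P" for c
    unfolding good_def
  proof (rule uniform_frame_pointed[where k = "2 * sz c"])
    have ck: "c \<le> k" "sz c > 0" using c unfolding hole_def P_def V_def by auto
    show "uniform_frame 3 (Suc (2 * sz c))" using three[OF ck] by simp
    show "card {p \<in> P. hole p = c} = 2 * sz c * 3" using cardA[OF ck(1)] by simp
  qed (use finP finY disj in \<open>auto simp: Y_def\<close>)
  then obtain sub R where g: "\<And>c. c \<in> hole ` P \<Longrightarrow> good c (sub c) (R c)" by metis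
  have sub: "hframe ({p \<in> P. hole p = c} \<union> Y) (sub c) (R c)" if "c \<in> hole ` P" for c
    using g[OF that] unfolding good_def by (rule conjunct1)
  have subY: "sub c y = 0" if "c \<in> hole ` P" "y \<in> Y" for c y
    using g[OF that(1)] that(2) unfolding good_def by blast
  have subP: "sub (hole p) p \<noteq> 0" if "p \<in> P" for p
    using g[of "hole p"] that unfolding good_def by blast
  have subc: "card {b \<in> {q \<in> P. hole q = hole p}. sub (hole p) b = sub (hole p) p} = 3" if "p \<in> P" for p
    using g[of "hole p"] that unfolding good_def by blast
  define h where "h = (\<lambda>p. if p \<in> Y then None else Some (hole p, sub (hole p) p))"
  have big: "hframe (P \<union> Y) h (Q \<union> (\<Union>c\<in>hole ` P. R c))"
    unfolding h_def by (rule fill_holes[OF fr finY disj sub subY subP])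
  show ?thesis
  proof (rule uniform_frameI[OF big])
    fix p assume p: "p \<in> P \<union> Y"
    show "card {q \<in> P \<union> Y. h q = h p} = 3"
    proof (cases "p \<in> Y")
      case True
      then have "{q \<in> P \<union> Y. h q = h p} = Y" using disj unfolding h_def by auto
      then show ?thesis unfolding Y_def by simp
    next
      case False
      then have "{q \<in> P \<union> Y. h q = h p} = {b \<in> {q \<in> P. hole q = hole p}. sub (hole p) b = sub (hole p) p}"
        using disj p unfolding h_def by auto
      then show ?thesis using subc[of p] False p by auto
    qed
  next
    show "card (P \<union> Y) = (2 * (\<Sum>j\<le>k. sz j) + 1) * 3"
      using card_Un_disjoint[OF finP finY disj] cardV unfolding P_def Y_def by (simp add: card_cartesian_product)
  qed simp
qed

section \<open>Development of base tuples\<close>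

fun merge_int :: "int list \<Rightarrow> int list \<Rightarrow> int list" where
  "merge_int [] ys = ys"
| "merge_int xs [] = xs"
| "merge_int (x # xs) (y # ys) = (if x \<le> y then x # merge_int xs (y # ys) else y # merge_int (x # xs) ys)"

fun merge_adj :: "int list list \<Rightarrow> int list list" where
  "merge_adj (x # y # zs) = merge_int x y # merge_adj zs"
| "merge_adj xs = xs"

lemma length_merge_adj: "length (merge_adj xs) \<le> length xs"
  by (induction xs rule: merge_adj.induct) auto

function merge_all :: "int list list \<Rightarrow> int list" where
  "merge_all [] = []"
| "merge_all [x] = x"
| "merge_all (x # y # zs) = merge_all (merge_adj (x # y # zs))"
  by pat_completeness auto
termination
  by (relation "measure length") (auto simp: less_Suc_eq_le intro: le_trans[OF length_merge_adj])

text \<open>Equality of \<open>msort xs\<close> with a given distinct list can be evaluated; by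
  \<open>mset_msort\<close> it means that \<open>xs\<close> contains each entry of that list exactly
  once.\<close>

definition msort :: "int list \<Rightarrow> int list" where
  "msort xs = merge_all (map (\<lambda>x. [x]) xs)"

lemma mset_merge_int: "mset (merge_int xs ys) = mset xs + mset ys"
  by (induction xs ys rule: merge_int.induct) auto

lemma mset_merge_adj: "mset (concat (merge_adj xs)) = mset (concat xs)"
  by (induction xs rule: merge_adj.induct) (auto simp: mset_merge_int)

lemma mset_merge_all: "mset (merge_all xs) = mset (concat xs)"
  by (induction xs rule: merge_all.induct) (simp_all add: mset_merge_adj mset_merge_int del: merge_adj.simps)

lemma mset_msort: "mset (msort xs) = mset xs"
proof -
  have "concat (map (\<lambda>x. [x]) xs) = xs" by (induction xs) auto
  then show ?thesis unfolding msort_def mset_merge_all by simp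
qed

section \<open>Base games and orbits of ordered pairs\<close>

definition expand :: "('a \<times> 'a \<times> 'a \<times> 'a \<times> 'a) list \<Rightarrow> 'a list list" where
  "expand U = concat (map (\<lambda>(a, b, c, d, s). [[a, c, b, d, s], [c, a, d, b, s]]) U)"

text \<open>A tuple \<open>(a, b, c, d, s)\<close> stands for the game of man \<open>a\<close> and woman \<open>b\<close> against man \<open>c\<close> and woman \<open>d\<close> in
  round \<open>s\<close>. The function \<open>orb\<close> numbers the orbits of ordered pairs, and \<open>L\<close> lists the numbers of the orbits of
  pairs in different holes.\<close>

definition orbits_ok :: "('a \<Rightarrow> 'a \<Rightarrow> int) \<Rightarrow> int list \<Rightarrow> ('a \<times> 'a \<times> 'a \<times> 'a \<times> 'a) list \<Rightarrow> bool" where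
  "orbits_ok orb L U \<longleftrightarrow>
     msort (concat (map (\<lambda>(a, b, c, d, s). [orb a c, orb c a]) U)) = L \<and>
     msort (concat (map (\<lambda>(a, b, c, d, s). [orb b d, orb d b]) U)) = L \<and>
     msort (concat (map (\<lambda>(a, b, c, d, s). [orb a b, orb c d]) U)) = L \<and>
     msort (concat (map (\<lambda>(a, b, c, d, s). [orb a d, orb c b]) U)) = L \<and>
     msort (concat (map (\<lambda>(a, b, c, d, s). [orb a s, orb c s]) U)) = L \<and>
     msort (concat (map (\<lambda>(a, b, c, d, s). [orb b s, orb d s]) U)) = L"

text \<open>Each game enters under both orders of its teams, so the six lists of
  \<open>orbits_ok\<close> are the orbit numbers in the six pairs of columns that
  \<open>hframeI\<close> asks for.\<close>

lemma map_expand: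
  "map (\<lambda>t. f (t ! 0) (t ! 1)) (expand U) = concat (map (\<lambda>(a, b, c, d, s). [f a c, f c a]) U)"
  "map (\<lambda>t. f (t ! 2) (t ! 3)) (expand U) = concat (map (\<lambda>(a, b, c, d, s). [f b d, f d b]) U)"
  "map (\<lambda>t. f (t ! 0) (t ! 2)) (expand U) = concat (map (\<lambda>(a, b, c, d, s). [f a b, f c d]) U)"
  "map (\<lambda>t. f (t ! 0) (t ! 3)) (expand U) = concat (map (\<lambda>(a, b, c, d, s). [f a d, f c b]) U)"
  "map (\<lambda>t. f (t ! 0) (t ! 4)) (expand U) = concat (map (\<lambda>(a, b, c, d, s). [f a s, f c s]) U)"
  "map (\<lambda>t. f (t ! 2) (t ! 4)) (expand U) = concat (map (\<lambda>(a, b, c, d, s). [f b s, f d s]) U)"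
  unfolding expand_def by (induction U) auto

lemma swap5_expand: "t \<in> set (expand U) \<Longrightarrow> swap5 t \<in> set (expand U)"
  unfolding expand_def swap5_def by fastforce

text \<open>The method of differences. In each of the six pairs of columns, the base tuples
  represent every orbit of pairs in different holes exactly once, and the action on such an orbit is
  sharply transitive. So any pair arises from one base tuple and one group element.\<close>

lemma development:
  fixes act :: "'g \<Rightarrow> 'a \<Rightarrow> 'a"
  assumes fin: "finite P"
    and act_in: "\<And>g p. g \<in> \<Gamma> \<Longrightarrow> p \<in> P \<Longrightarrow> act g p \<in> P"
    and act_hole: "\<And>g p q. g \<in> \<Gamma> \<Longrightarrow> p \<in> P \<Longrightarrow> q \<in> P \<Longrightarrow> hole (act g p) = hole (act g q) \<longleftrightarrow> hole p = hole q"
    and act_orb: "\<And>g p q. g \<in> \<Gamma> \<Longrightarrow> p \<in> P \<Longrightarrow> q \<in> P \<Longrightarrow> hole p \<noteq> hole q \<Longrightarrow> orb (act g p) (act g q) = orb p q"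
    and orb_act: "\<And>p q p' q'. p \<in> P \<Longrightarrow> q \<in> P \<Longrightarrow> p' \<in> P \<Longrightarrow> q' \<in> P \<Longrightarrow> hole p \<noteq> hole q \<Longrightarrow> hole p' \<noteq> hole q' \<Longrightarrow>
       orb p q = orb p' q' \<Longrightarrow> \<exists>!g. g \<in> \<Gamma> \<and> act g p = p' \<and> act g q = q'"
    and orb_L: "\<And>p q. p \<in> P \<Longrightarrow> q \<in> P \<Longrightarrow> orb p q \<in> set L \<longleftrightarrow> hole p \<noteq> hole q"
    and L: "distinct L"
    and U: "\<And>a b c d s. (a, b, c, d, s) \<in> set U \<Longrightarrow> {a, b, c, d, s} \<subseteq> P"
    and ok: "orbits_ok orb L U"
  shows "hframe P hole {map (act g) t | g t. g \<in> \<Gamma> \<and> t \<in> set (expand U)}" (is "hframe P hole ?Q")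
proof -
  have inP: "length t = 5 \<and> set t \<subseteq> P" if "t \<in> set (expand U)" for t
    using that U unfolding expand_def by fastforce
  have nthP: "t ! i \<in> P" if "t \<in> set (expand U)" "i < 5" for t i
    using inP[OF that(1)] that(2) by (metis nth_mem subsetD)
  have six: "distinct (map (\<lambda>t. orb (t ! i) (t ! j)) (expand U)) \<and> set (map (\<lambda>t. orb (t ! i) (t ! j)) (expand U)) = set L"
    if "(i, j) \<in> {(0, 1), (2, 3), (0, 2), (0, 3), (0, 4), (2, 4)}" for i j
  proof -
    have "msort (map (\<lambda>t. orb (t ! i) (t ! j)) (expand U)) = L"
      using that ok unfolding orbits_ok_def by (auto simp only: map_expand[symmetric] insert_iff empty_iff prod.inject)
    then have "mset (map (\<lambda>t. orb (t ! i) (t ! j)) (expand U)) = mset L"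
      by (metis mset_msort)
    then show ?thesis
      using L by (metis mset_eq_imp_distinct_iff mset_eq_setD)
  qed
  have hne: "hole (t ! i) \<noteq> hole (t ! j)"
    if "(i, j) \<in> {(0, 1), (2, 3), (0, 2), (0, 3), (0, 4), (2, 4)}" "t \<in> set (expand U)" for i j t
  proof -
    have "orb (t ! i) (t ! j) \<in> set L" using six[OF that(1)] that(2) by auto
    then show ?thesis using orb_L nthP[OF that(2)] that(1) by auto
  qed
  \<comment> \<open>The pairs of columns missing from the six are read off from the swapped tuple,
    which is also a base tuple.\<close>
  have dist: "distinct (map hole t)" if t: "t \<in> set (expand U)" for t
  proof -
    obtain a b c d e where abc: "t = [a, b, c, d, e]" using inP[OF t] length5_cases by blast
    have sw: "swap5 t \<in> set (expand U)" using swap5_expand[OF t] .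
    show ?thesis
      using hne[of 0 1, OF _ t] hne[of 2 3, OF _ t] hne[of 0 2, OF _ t] hne[of 0 3, OF _ t] hne[of 0 4, OF _ t] hne[of 2 4, OF _ t]
        hne[of 0 2, OF _ sw] hne[of 0 3, OF _ sw] hne[of 0 4, OF _ sw] hne[of 2 4, OF _ sw]
      unfolding abc by (simp add: swap5_def)
  qed
  show ?thesis
  proof (rule hframeI[OF fin])
    fix t assume "t \<in> ?Q"
    then obtain g u where u: "g \<in> \<Gamma>" "u \<in> set (expand U)" "t = map (act g) u" by blast
    have "distinct (map hole t)"
      unfolding distinct_conv_nth
    proof (intro allI impI)
      fix i j assume ij: "i < length (map hole t)" "j < length (map hole t)" "i \<noteq> j"
      then have l: "i < 5" "j < 5" using u inP by auto
      have "map hole u ! i \<noteq> map hole u ! j"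
        using dist[OF u(2)] inP[OF u(2)] l ij(3) by (metis length_map nth_eq_iff_index_eq)
      then have "hole (u ! i) \<noteq> hole (u ! j)" using inP[OF u(2)] l by simp
      then show "map hole t ! i \<noteq> map hole t ! j"
        using act_hole[OF u(1) nthP[OF u(2) l(1)] nthP[OF u(2) l(2)]] u inP[OF u(2)] l by simp
    qed
    moreover have "swap5 t \<in> ?Q"
      using u swap5_expand[OF u(2)] map_swap5[of u "act g"] inP[OF u(2)] by (auto intro!: exI[of _ g] exI[of _ "swap5 u"])
    ultimately show "length t = 5 \<and> set t \<subseteq> P \<and> distinct (map hole t) \<and> swap5 t \<in> ?Q"
      using u inP[OF u(2)] act_in[OF u(1)] by auto
  next
    fix i j :: nat and p q assume ij: "(i, j) \<in> {(0, 1), (2, 3), (0, 2), (0, 3), (0, 4), (2, 4)}"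
      and pq: "p \<in> P" "q \<in> P" "hole p \<noteq> hole q"
    have l: "i < 5" "j < 5" using ij by auto
    have d: "distinct (map (\<lambda>t. orb (t ! i) (t ! j)) (expand U))"
      and s: "set (map (\<lambda>t. orb (t ! i) (t ! j)) (expand U)) = set L"
      using six[OF ij] by blast+
    have "orb p q \<in> set L" using orb_L pq by blast
    then have "orb p q \<in> (\<lambda>t. orb (t ! i) (t ! j)) ` set (expand U)" using s by simp
    then obtain u where u: "u \<in> set (expand U)" "orb (u ! i) (u ! j) = orb p q"
      by (metis (no_types, lifting) imageE)
    have ex: "\<exists>!g. g \<in> \<Gamma> \<and> act g (u ! i) = p \<and> act g (u ! j) = q"
      using orb_act[OF nthP[OF u(1) l(1)] nthP[OF u(1) l(2)] pq(1,2) hne[OF ij u(1)] pq(3) u(2)] .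
    then obtain g where g: "g \<in> \<Gamma>" "act g (u ! i) = p" "act g (u ! j) = q" by blast
    show "\<exists>!t. t \<in> ?Q \<and> t ! i = p \<and> t ! j = q"
    proof (rule ex1I[of _ "map (act g) u"])
      show "map (act g) u \<in> ?Q \<and> map (act g) u ! i = p \<and> map (act g) u ! j = q"
        using g u inP[OF u(1)] l by auto
      fix t assume t: "t \<in> ?Q \<and> t ! i = p \<and> t ! j = q"
      then obtain g' u' where u': "g' \<in> \<Gamma>" "u' \<in> set (expand U)" "t = map (act g') u'" by blast
      then have a': "act g' (u' ! i) = p" "act g' (u' ! j) = q" using t inP[OF u'(2)] l by auto
      then have "orb (u' ! i) (u' ! j) = orb p q"
        using act_orb[OF u'(1) nthP[OF u'(2) l(1)] nthP[OF u'(2) l(2)] hne[OF ij u'(2)]] by simp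
      \<comment> \<open>No orbit number repeats in these two columns, so the orbit of
        \<open>(p, q)\<close> determines the base tuple.\<close>
      then have "u' = u" using d u u'(2) unfolding distinct_map inj_on_def by auto
      then have "g' = g" using ex g u'(1) a' by blast
      then show "t = map (act g) u" using \<open>u' = u\<close> u' by blast
    qed
  qed
qed

subsection \<open>Holes of size three\<close>

text \<open>The orbit of an ordered pair under translation is its difference in the product of the
  integers modulo \<open>n\<close> and modulo 3, packed as \<open>3 x' + y'\<close>. It is computed
  by comparisons and additions alone; \<open>orb3_eq\<close> recovers the form with
  \<open>mod\<close>.\<close>

definition orb3 :: "int \<Rightarrow> int \<times> int \<Rightarrow> int \<times> int \<Rightarrow> int" where
  "orb3 n p q = (let x = fst q - fst p; x' = (if x < 0 then x + n else x);
      y = snd q - snd p; y' = (if y < 0 then y + 3 else y) in x' + x' + x' + y')"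

text \<open>The integer \<open>3 x + i\<close> encodes the point \<open>(x, i)\<close>; all games of a starter belong to round \<open>(0, 0)\<close>.\<close>

definition decode3 :: "int \<times> int \<times> int \<times> int \<Rightarrow> (int \<times> int) \<times> (int \<times> int) \<times> (int \<times> int) \<times> (int \<times> int) \<times> (int \<times> int)" where
  "decode3 = (\<lambda>(a, b, c, d). ((a div 3, a mod 3), (b div 3, b mod 3), (c div 3, c mod 3), (d div 3, d mod 3), (0, 0)))"

text \<open>As all base games are in round (0, 0), the last two conditions of
  \<open>orbits_ok\<close> say that every point outside the hole of (0, 0) plays there once as a man
  and once as a woman. The list \<open>[3..3 * n - 1]\<close> encodes the differences with nonzero
  first component.\<close>

definition starter :: "int \<Rightarrow> (int \<times> int \<times> int \<times> int) list \<Rightarrow> bool" where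
  "starter n T \<longleftrightarrow> n > 0 \<and>
     list_all (\<lambda>(a, b, c, d). 0 \<le> a \<and> a < 3 * n \<and> 0 \<le> b \<and> b < 3 * n \<and> 0 \<le> c \<and> c < 3 * n \<and> 0 \<le> d \<and> d < 3 * n) T \<and>
     orbits_ok (orb3 n) [3..3 * n - 1] (map decode3 T)"

lemma orb3_eq:
  assumes "0 \<le> x" "x < n" "0 \<le> y" "y < n" "0 \<le> i" "i < 3" "0 \<le> j" "j < 3"
  shows "orb3 n (x, i) (y, j) = 3 * ((y - x) mod n) + (j - i) mod 3"
proof -
  have "(y - x) mod n = (if y - x < 0 then y - x + n else y - x)"
  proof (cases "y - x < 0")
    case True
    have "(y - x) mod n = (y - x + n) mod n" by simp
    also have "\<dots> = y - x + n" using assms True by (intro mod_pos_pos_trivial) auto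
    finally show ?thesis using True by simp
  next
    case False
    then show ?thesis using assms by (simp add: mod_pos_pos_trivial)
  qed
  moreover have "(j - i) mod 3 = (if j - i < 0 then j - i + 3 else j - i)"
    using assms by presburger
  ultimately show ?thesis by (simp add: orb3_def Let_def)
qed

lemma mod_add_inj:
  fixes x y g n :: int
  assumes "(x + g) mod n = (y + g) mod n" "0 \<le> x" "x < n" "0 \<le> y" "y < n"
  shows "x = y"
  using assms by (metis mod_add_right_eq mod_diff_left_eq add_diff_cancel_right' mod_pos_pos_trivial)

text \<open>The points themselves form the translation group, which acts regularly: a difference is
  a complete invariant of ordered pairs, and the translation between two pairs with equal difference
  is determined by their first points.\<close>

lemma starter_imp_frame:
  assumes "starter n T"
  shows "uniform_frame 3 (nat n)"
proof -
  define P where "P = {0..<n} \<times> {0..<3 :: int}"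
  define act where "act g p = ((fst p + fst g) mod n, (snd p + snd g) mod 3)" for g p :: "int \<times> int"
  have n: "n > 0" using assms unfolding starter_def by blast
  have orb: "orb3 n p q = 3 * ((fst q - fst p) mod n) + (snd q - snd p) mod 3" if "p \<in> P" "q \<in> P" for p q
    using orb3_eq[of "fst p" n "fst q" "snd p" "snd q"] that unfolding P_def by auto
  have nz: "(y - x) mod n = 0 \<longleftrightarrow> x = y" if "0 \<le> x" "x < n" "0 \<le> y" "y < n" for x y
    using that by (metis cancel_comm_monoid_add_class.diff_cancel eq_iff_diff_eq_0 mod_0 mod_0_imp_dvd mod_eq_dvd_iff mod_pos_pos_trivial)
  have "hframe P fst {map (act g) t | g t. g \<in> P \<and> t \<in> set (expand (map decode3 T))}"
  proof (rule development[where orb = "orb3 n" and L = "[3..3 * n - 1]"])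
    show "finite P" unfolding P_def by simp
    show in': "act g p \<in> P" if "g \<in> P" "p \<in> P" for g p using n unfolding act_def P_def by auto
    show "fst (act g p) = fst (act g q) \<longleftrightarrow> fst p = fst q" if "g \<in> P" "p \<in> P" "q \<in> P" for g p q
      using that mod_add_inj[of "fst p" "fst g" n "fst q"] unfolding act_def P_def by auto
    show "orb3 n (act g p) (act g q) = orb3 n p q" if "g \<in> P" "p \<in> P" "q \<in> P" for g p q
      using that in' by (simp add: orb) (simp add: act_def mod_simps)
    show "orb3 n p q \<in> set [3..3 * n - 1] \<longleftrightarrow> fst p \<noteq> fst q" if "p \<in> P" "q \<in> P" for p q
    proof -
      have "0 \<le> (fst q - fst p) mod n" "(fst q - fst p) mod n < n" "(fst q - fst p) mod n = 0 \<longleftrightarrow> fst p = fst q"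
        using n nz[of "fst p" "fst q"] that unfolding P_def by auto
      moreover have "0 \<le> (snd q - snd p) mod 3" "(snd q - snd p) mod 3 < 3" by auto
      ultimately show ?thesis unfolding orb[OF that] by auto
    qed
    show "\<exists>!g. g \<in> P \<and> act g p = p' \<and> act g q = q'"
      if P: "p \<in> P" "q \<in> P" "p' \<in> P" "q' \<in> P" and eq: "orb3 n p q = orb3 n p' q'" for p q p' q'
    proof -
      have "A = C \<and> B = D" if "3 * A + B = 3 * C + D" "0 \<le> B" "B < 3" "0 \<le> D" "D < 3" for A B C D :: int
        using that by presburger
      from this[OF eq[unfolded orb[OF P(1,2)] orb[OF P(3,4)]]]
      have e: "(fst q - fst p) mod n = (fst q' - fst p') mod n" "(snd q - snd p) mod 3 = (snd q' - snd p') mod 3"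
        by auto
      define g where "g = ((fst p' - fst p) mod n, (snd p' - snd p) mod 3)"
      have gP: "g \<in> P" using n unfolding g_def P_def by auto
      have a1: "act g p = p'" using P unfolding g_def act_def P_def by (auto simp: mod_simps)
      have "(fst q + (fst p' - fst p) mod n) mod n = ((fst q - fst p) mod n + fst p') mod n"
        by (simp add: mod_simps algebra_simps)
      also have "\<dots> = fst q'" unfolding e using P(4) by (auto simp: mod_simps P_def)
      finally have b1: "(fst q + fst g) mod n = fst q'" unfolding g_def by simp
      have "(snd q + (snd p' - snd p) mod 3) mod 3 = ((snd q - snd p) mod 3 + snd p') mod 3"
        by (simp add: mod_simps algebra_simps)
      also have "\<dots> = snd q'" unfolding e using P(4) by (auto simp: mod_simps P_def)
      finally have b2: "(snd q + snd g) mod 3 = snd q'" unfolding g_def by simp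
      show ?thesis
      proof (rule ex1I[of _ g])
        show "g \<in> P \<and> act g p = p' \<and> act g q = q'" using gP a1 b1 b2 by (simp add: act_def)
        fix h assume h: "h \<in> P \<and> act h p = p' \<and> act h q = q'"
        then have "(fst h + fst p) mod n = (fst g + fst p) mod n" "(snd h + snd p) mod 3 = (snd g + snd p) mod 3"
          using a1 unfolding act_def by (auto simp: add.commute)
        then have "fst h = fst g" "snd h = snd g"
          using h gP mod_add_inj[of "fst h" "fst p" n "fst g"] mod_add_inj[of "snd h" "snd p" 3 "snd g"] unfolding P_def by auto
        then show "h = g" by (simp add: prod_eq_iff)
      qed
    qed
    show "{a, b, c, d, s} \<subseteq> P" if m: "(a, b, c, d, s) \<in> set (map decode3 T)" for a b c d s
    proof -
      obtain a' b' c' d' where t: "(a', b', c', d') \<in> set T" "(a, b, c, d, s) = decode3 (a', b', c', d')"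
        using m by auto
      then have "0 \<le> a' \<and> a' < 3 * n \<and> 0 \<le> b' \<and> b' < 3 * n \<and> 0 \<le> c' \<and> c' < 3 * n \<and> 0 \<le> d' \<and> d' < 3 * n"
        using assms unfolding starter_def by (auto simp: list_all_iff)
      then show ?thesis using t(2) n unfolding decode3_def P_def by auto
    qed
    show "orbits_ok (orb3 n) [3..3 * n - 1] (map decode3 T)" using assms unfolding starter_def by blast
  qed simp
  then show ?thesis
  proof (rule uniform_frameI)
    fix p assume "p \<in> P"
    then have "{q \<in> P. fst q = fst p} = {fst p} \<times> {0..<3}" unfolding P_def by auto
    then show "card {q \<in> P. fst q = fst p} = 3" by simp
  next
    show "card P = nat n * 3" unfolding P_def by simp
  qed simp
qed

subsection \<open>Holes of size six\<close>

text \<open>The value \<open>p\<close> is a point at infinity. Two finite coordinates have their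
  difference as gap; the gaps \<open>p\<close> and \<open>p + 1\<close> are reserved for pairs that
  end or begin at infinity. Both with and without infinity, the nonzero gaps are the numbers from 1
  to \<open>2 * N - p - 1\<close>.\<close>

definition gap6 :: "int \<Rightarrow> int \<Rightarrow> int \<Rightarrow> int" where
  "gap6 p x y = (if x = y then 0 else if x = p then p + 1 else if y = p then p
     else if y - x < 0 then y - x + p else y - x)"

text \<open>Translations fix the second coordinates, so both of them belong to the invariant; they
  become the two lowest digits in base 6. The smaller group is also why these base games name their
  rounds.\<close>

definition orb6 :: "int \<Rightarrow> int \<times> int \<Rightarrow> int \<times> int \<Rightarrow> int" where
  "orb6 p a b = 36 * gap6 p (fst a) (fst b) + 6 * snd a + snd b"

definition decode6 :: "int \<times> int \<times> int \<times> int \<times> int \<Rightarrow> (int \<times> int) \<times> (int \<times> int) \<times> (int \<times> int) \<times> (int \<times> int) \<times> (int \<times> int)" where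
  "decode6 = (\<lambda>(a, b, c, d, s). ((a div 6, a mod 6), (b div 6, b mod 6), (c div 6, c mod 6), (d div 6, d mod 6), (s div 6, s mod 6)))"

text \<open>The integer \<open>6 x + c\<close> encodes the point \<open>(x, c)\<close>. The integers modulo \<open>p\<close> act by translation on \<open>x < p\<close>;
  if \<open>N = p + 1\<close>, then the points of the last hole are fixed.\<close>

definition starter6 :: "int \<Rightarrow> int \<Rightarrow> (int \<times> int \<times> int \<times> int \<times> int) list \<Rightarrow> bool" where
  "starter6 p N T \<longleftrightarrow> p > 0 \<and> (N = p \<or> N = p + 1) \<and>
     list_all (\<lambda>(a, b, c, d, s). 0 \<le> a \<and> a < 6 * N \<and> 0 \<le> b \<and> b < 6 * N \<and> 0 \<le> c \<and> c < 6 * N \<and>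
        0 \<le> d \<and> d < 6 * N \<and> 0 \<le> s \<and> s < 6 * N) T \<and>
     orbits_ok (orb6 p) [36..36 * (2 * N - p) - 1] (map decode6 T)"

lemma gap6_finite:
  assumes "0 \<le> x" "x < p" "0 \<le> y" "y < p"
  shows "gap6 p x y = (y - x) mod p"
proof (cases "y - x < 0")
  case True
  have "(y - x) mod p = (y - x + p) mod p" by simp
  also have "\<dots> = y - x + p" using assms True by (intro mod_pos_pos_trivial) auto
  finally show ?thesis using assms True by (simp add: gap6_def)
next
  case False
  then show ?thesis using assms by (auto simp: gap6_def mod_pos_pos_trivial)
qed

lemma shift_ex1:
  fixes x x' p :: int
  assumes "0 \<le> x" "x < p" "0 \<le> x'" "x' < p"
  shows "\<exists>!g. g \<in> {0..<p} \<and> (x + g) mod p = x'"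
proof (rule ex1I[of _ "(x' - x) mod p"])
  show "(x' - x) mod p \<in> {0..<p} \<and> (x + (x' - x) mod p) mod p = x'"
    using assms by (auto simp: mod_simps)
  fix g assume g: "g \<in> {0..<p} \<and> (x + g) mod p = x'"
  then have "(x' - x) mod p = g mod p" using assms by (metis add_diff_cancel_left' mod_diff_left_eq)
  then show "g = (x' - x) mod p" using g by (simp add: mod_pos_pos_trivial)
qed

text \<open>All points at infinity lie in one hole, so a pair in different holes has a finite
  member, and the image of that member determines the translation.\<close>

lemma starter6_imp_frame:
  assumes "starter6 p N T"
  shows "uniform_frame 6 (nat N)"
proof -
  define P where "P = {0..<N} \<times> {0..<6 :: int}"
  define act where "act g q = (if fst q = p then q else ((fst q + g) mod p, snd q))" for g and q :: "int \<times> int"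
  have p: "p > 0" and N: "N = p \<or> N = p + 1" using assms unfolding starter6_def by blast+
  have rng: "0 \<le> fst q" "fst q = p \<or> fst q < p" "0 \<le> snd q" "snd q < 6" if "q \<in> P" for q
    using that N unfolding P_def by auto
  have gap_range: "0 \<le> gap6 p (fst a) (fst b)" "gap6 p (fst a) (fst b) < 2 * N - p"
      "gap6 p (fst a) (fst b) = 0 \<longleftrightarrow> fst a = fst b" if "a \<in> P" "b \<in> P" for a b
    using that N p unfolding gap6_def P_def by auto
  have act_fst: "fst (act g q) = p \<longleftrightarrow> fst q = p" for g q
    using p by (auto simp: act_def) (metis less_irrefl pos_mod_bound)
  have act_snd: "snd (act g q) = snd q" for g q by (simp add: act_def)
  have act_in: "act g q \<in> P" if "q \<in> P" for g q
  proof -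
    have "(fst q + g) mod p < N" using pos_mod_bound[OF p, of "fst q + g"] N by linarith
    then show ?thesis using that p unfolding act_def P_def by (simp add: mem_Times_iff)
  qed
  have act_eq: "fst (act g a) = fst (act g b) \<longleftrightarrow> fst a = fst b" if "a \<in> P" "b \<in> P" for g a b
  proof (cases "fst a = p \<or> fst b = p")
    case True
    then show ?thesis using act_fst by metis
  next
    case False
    then show ?thesis using mod_add_inj[of "fst a" g p "fst b"] rng[OF that(1)] rng[OF that(2)] by (auto simp: act_def)
  qed
  have fin: "fst (act g q) = (fst q + g) mod p" if "fst q \<noteq> p" for g q using that by (simp add: act_def)
  have gap_act: "gap6 p (fst (act g a)) (fst (act g b)) = gap6 p (fst a) (fst b)" if ab: "a \<in> P" "b \<in> P" for g a b
  proof (cases "fst a = p \<or> fst b = p")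
    case True
    have "fst (act g a) = p \<longleftrightarrow> fst a = p" "fst (act g b) = p \<longleftrightarrow> fst b = p" using act_fst by auto
    then show ?thesis using True act_eq[OF ab] unfolding gap6_def by auto
  next
    case False
    have "gap6 p (fst (act g a)) (fst (act g b)) = (fst (act g b) - fst (act g a)) mod p"
      using rng(1,2)[OF act_in[OF ab(1)]] rng(1,2)[OF act_in[OF ab(2)]] act_fst False by (intro gap6_finite) auto
    also have "\<dots> = (fst b - fst a) mod p" using False by (simp add: fin mod_simps)
    also have "\<dots> = gap6 p (fst a) (fst b)"
      using rng(1,2)[OF ab(1)] rng(1,2)[OF ab(2)] False by (intro gap6_finite[symmetric]) auto
    finally show ?thesis .
  qed
  have split: "A = A' \<and> B = B' \<and> C = C'"
    if "36 * A + 6 * B + C = 36 * A' + 6 * B' + C'" "0 \<le> B" "B < 6" "0 \<le> C" "C < 6" "0 \<le> B'" "B' < 6" "0 \<le> C'" "C' < 6"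
    for A B C A' B' C' :: int
  proof -
    have two: "x = x' \<and> y = y'" if "6 * x + y = 6 * x' + y'" "0 \<le> y" "y < 6" "0 \<le> y'" "y' < 6" for x y x' y' :: int
      using that by presburger
    show ?thesis using two[of "6 * A + B" C "6 * A' + B'" C'] two[of A B A' B'] that by simp
  qed
  have "hframe P fst {map (act g) t | g t. g \<in> {0..<p} \<and> t \<in> set (expand (map decode6 T))}"
  proof (rule development[where orb = "orb6 p" and L = "[36..36 * (2 * N - p) - 1]"])
    show "finite P" unfolding P_def by simp
    show "act g q \<in> P" if "q \<in> P" for g q using act_in[OF that] .
    show "fst (act g a) = fst (act g b) \<longleftrightarrow> fst a = fst b" if "a \<in> P" "b \<in> P" for g a b using act_eq[OF that] .
    show "orb6 p (act g a) (act g b) = orb6 p a b" if "a \<in> P" "b \<in> P" for g a b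
      unfolding orb6_def gap_act[OF that] act_snd ..
    show "orb6 p a b \<in> set [36..36 * (2 * N - p) - 1] \<longleftrightarrow> fst a \<noteq> fst b" if ab: "a \<in> P" "b \<in> P" for a b
      using gap_range[OF ab] rng(3,4)[OF ab(1)] rng(3,4)[OF ab(2)] unfolding orb6_def by auto
    show "\<exists>!g. g \<in> {0..<p} \<and> act g a = a' \<and> act g b = b'"
      if P: "a \<in> P" "b \<in> P" "a' \<in> P" "b' \<in> P" and ne: "fst a \<noteq> fst b" "fst a' \<noteq> fst b'"
        and eq: "orb6 p a b = orb6 p a' b'" for a b a' b'
    proof -
      have e: "gap6 p (fst a) (fst b) = gap6 p (fst a') (fst b')" and s: "snd a = snd a'" "snd b = snd b'"
        using split[OF eq[unfolded orb6_def]] rng(3,4)[OF P(1)] rng(3,4)[OF P(2)] rng(3,4)[OF P(3)] rng(3,4)[OF P(4)] by auto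
      have lt: "gap6 p x y < p" if "0 \<le> x" "x < p" "0 \<le> y" "y < p" for x y
        using that p by (simp add: gap6_finite)
      \<comment> \<open>The gaps of finite pairs stay below \<open>p\<close>, so equal gaps put
        infinity in the same position of both pairs.\<close>
      have inf: "fst a = p \<longleftrightarrow> fst a' = p" "fst b = p \<longleftrightarrow> fst b' = p"
        using e ne lt[of "fst a" "fst b"] lt[of "fst a'" "fst b'"] rng(1,2)[OF P(1)] rng(1,2)[OF P(2)] rng(1,2)[OF P(3)] rng(1,2)[OF P(4)]
        unfolding gap6_def by (auto split: if_splits)
      have one: "act g q = q' \<longleftrightarrow> (fst q + g) mod p = fst q'" if "fst q \<noteq> p" "snd q = snd q'" for g q q'
        using that by (auto simp: act_def prod_eq_iff)
      have fixed: "act g q = q'" if "fst q = p" "fst q' = p" "snd q = snd q'" for g q q'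
        using that by (auto simp: act_def prod_eq_iff)
      consider "fst a = p" "fst b \<noteq> p" | "fst a \<noteq> p" "fst b = p" | "fst a \<noteq> p" "fst b \<noteq> p" using ne by auto
      then show ?thesis
      proof cases
        case 1
        then show ?thesis
          using shift_ex1[of "fst b" p "fst b'"] one[OF 1(2) s(2)] fixed[OF 1(1) _ s(1)] inf rng(1,2)[OF P(2)] rng(1,2)[OF P(4)] by auto
      next
        case 2
        then show ?thesis
          using shift_ex1[of "fst a" p "fst a'"] one[OF 2(1) s(1)] fixed[OF 2(2) _ s(2)] inf rng(1,2)[OF P(1)] rng(1,2)[OF P(3)] by auto
      next
        case 3
        have r: "0 \<le> fst a" "fst a < p" "0 \<le> fst b" "fst b < p" "0 \<le> fst a'" "fst a' < p" "0 \<le> fst b'" "fst b' < p"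
          using 3 inf rng(1,2)[OF P(1)] rng(1,2)[OF P(2)] rng(1,2)[OF P(3)] rng(1,2)[OF P(4)] by auto
        have d: "(fst b - fst a) mod p = (fst b' - fst a') mod p"
          using e r by (simp add: gap6_finite)
        have "(fst b + g) mod p = fst b'" if "(fst a + g) mod p = fst a'" for g
        proof -
          have "(fst b + g) mod p = ((fst b - fst a) mod p + (fst a + g) mod p) mod p" by (simp add: mod_simps)
          also have "\<dots> = ((fst b' - fst a') mod p + fst a') mod p" unfolding d that ..
          also have "\<dots> = fst b'" using r by (simp add: mod_simps)
          finally show ?thesis .
        qed
        then have "(act g a = a' \<and> act g b = b') \<longleftrightarrow> (fst a + g) mod p = fst a'" for g
          using one[OF 3(1) s(1)] one[OF 3(2) s(2)] by blast
        then show ?thesis using shift_ex1[of "fst a" p "fst a'"] r by simp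
      qed
    qed
    show "{a, b, c, d, s} \<subseteq> P" if m: "(a, b, c, d, s) \<in> set (map decode6 T)" for a b c d s
    proof -
      obtain a' b' c' d' s' where t: "(a', b', c', d', s') \<in> set T" "(a, b, c, d, s) = decode6 (a', b', c', d', s')"
        using m by auto
      then have "0 \<le> a' \<and> a' < 6 * N \<and> 0 \<le> b' \<and> b' < 6 * N \<and> 0 \<le> c' \<and> c' < 6 * N \<and> 0 \<le> d' \<and> d' < 6 * N \<and> 0 \<le> s' \<and> s' < 6 * N"
        using assms unfolding starter6_def by (auto simp: list_all_iff)
      then show ?thesis using t(2) unfolding decode6_def P_def by auto
    qed
    show "orbits_ok (orb6 p) [36..36 * (2 * N - p) - 1] (map decode6 T)" using assms unfolding starter6_def by blast
  qed simp
  then show ?thesis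
  proof (rule uniform_frameI)
    fix q assume "q \<in> P"
    then have "{r \<in> P. fst r = fst q} = {fst q} \<times> {0..<6}" unfolding P_def by auto
    then show "card {r \<in> P. fst r = fst q} = 6" by simp
  next
    show "card P = nat N * 6" unfolding P_def by simp
  qed simp
qed

section \<open>The starters\<close>

text \<open>Five and seven holes are developed modulo 5 and 7, six and eight holes with one further
  fixed hole. Here the four nonzero gaps and 36 pairs of second coordinates give 144 orbits; each of
  the 72 games covers two of them in every condition.\<close>

lemma starter6_5: "starter6 5 5
    [
     (0,6,22,25,15), (0,7,16,24,23), (0,8,29,12,20), (0,9,14,20,29), (0,10,21,16,25), (0,11,27,23,12),
     (0,12,26,11,22), (0,13,6,28,19), (0,14,20,27,7), (0,15,10,22,26), (0,16,28,21,8), (0,17,18,8,24),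
     (0,18,11,26,14), (0,19,7,15,27), (0,21,25,13,9), (0,23,17,9,28), (0,24,13,10,18), (0,25,15,19,10),
     (0,26,9,14,21), (0,27,23,17,11), (0,28,19,6,17), (0,29,8,18,16), (1,6,28,18,13), (1,7,23,26,16),
     (1,8,17,25,18), (1,10,15,21,24), (1,11,22,17,26), (1,12,19,9,25), (1,13,27,6,23), (1,14,7,29,20),
     (1,15,21,28,8), (1,16,11,23,27), (1,17,29,22,9), (1,20,8,16,28), (1,22,26,14,10), (1,24,9,19,17),
     (1,25,14,11,19), (1,26,16,20,11), (1,27,10,15,22), (1,29,20,7,12), (2,6,23,12,27), (2,7,29,19,14),
     (2,11,16,22,25), (2,13,20,10,26), (2,14,28,7,18), (2,15,8,24,21), (2,16,22,29,9), (2,21,9,17,29),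
     (2,23,27,15,11), (2,24,21,8,13), (2,25,10,20,12), (2,26,15,6,20), (2,27,17,21,6), (2,28,11,16,23),
     (3,6,17,23,26), (3,14,21,11,27), (3,15,29,8,19), (3,16,9,25,22), (3,17,23,24,10), (3,18,28,16,6),
     (3,22,10,12,24), (3,25,22,9,14), (3,26,11,21,13), (3,27,16,7,21), (4,15,22,6,28), (4,17,10,26,23),
     (4,19,29,17,7), (4,23,11,13,25), (4,26,23,10,15), (4,28,17,8,22), (5,12,11,27,18), (5,16,23,7,29)
    ]"
  by code_simp

lemma starter6_6: "starter6 5 6
    [
     (0,6,29,21,15), (0,7,23,34,17), (0,8,31,12,25), (0,9,20,32,24), (0,10,15,29,32), (0,11,24,23,16),
     (0,12,28,31,11), (0,13,18,7,27), (0,14,33,24,8), (0,15,7,22,34), (0,16,19,27,30), (0,17,35,8,20),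
     (0,18,10,30,29), (0,20,32,6,26), (0,21,25,16,35), (0,22,13,9,31), (0,23,34,26,14), (0,24,11,15,21),
     (0,25,17,35,23), (0,26,30,18,7), (0,27,14,33,6), (0,28,21,11,33), (0,30,26,14,19), (0,31,8,20,13),
     (0,32,16,19,10), (0,33,22,13,28), (0,34,9,28,18), (0,35,27,10,12), (1,6,19,12,28), (1,7,30,23,24),
     (1,8,15,32,29), (1,10,25,22,14), (1,11,26,20,17), (1,12,35,7,19), (1,13,9,31,26), (1,14,10,35,22),
     (1,15,22,26,32), (1,17,32,19,27), (1,18,34,25,13), (1,19,27,30,8), (1,20,28,34,16), (1,21,16,8,33),
     (1,23,33,13,9), (1,25,31,17,6), (1,26,21,33,11), (1,29,8,14,23), (1,30,11,29,12), (1,31,29,11,18),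
     (1,32,23,24,15), (1,33,17,6,21), (1,34,14,21,25), (1,35,20,15,7), (2,6,17,25,32), (2,7,26,19,12),
     (2,10,31,14,27), (2,11,22,32,26), (2,12,21,29,30), (2,13,35,10,22), (2,15,20,9,29), (2,16,33,26,10),
     (2,17,9,18,34), (2,18,15,11,31), (2,19,34,28,16), (2,22,32,8,28), (2,23,27,12,35), (2,24,23,7,33),
     (2,28,30,20,9), (2,29,16,33,8), (2,30,28,16,21), (2,31,10,22,15), (2,34,11,24,20), (2,35,29,6,14),
     (3,6,27,18,16), (3,7,28,22,13), (3,8,21,14,24), (3,9,30,19,26), (3,10,17,32,25), (3,13,32,21,29),
     (3,14,35,9,21), (3,15,11,31,28), (3,19,33,15,11), (3,20,34,27,15), (3,21,29,30,10), (3,25,10,16,19),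
     (3,27,31,13,8), (3,28,23,33,7), (3,34,16,23,27), (3,35,22,17,9), (4,6,31,16,29), (4,9,28,21,14),
     (4,12,33,28,6), (4,13,11,20,34), (4,14,23,25,30), (4,15,35,6,18), (4,17,22,11,25), (4,18,32,10,24),
     (4,19,29,14,35), (4,20,17,7,31), (4,21,34,24,12), (4,24,30,22,11), (5,8,29,20,12), (5,10,23,16,26),
     (5,11,30,21,28), (5,15,32,23,25), (5,16,35,11,23), (5,21,33,17,7), (5,22,34,29,17), (5,29,31,15,10)
    ]"
  by code_simp

lemma starter6_7: "starter6 7 7
    [
     (0,6,23,36,14), (0,7,28,38,12), (0,8,36,23,27), (0,9,40,16,34), (0,10,32,15,38), (0,11,12,26,21),
     (0,12,41,30,26), (0,13,10,32,24), (0,15,34,28,22), (0,16,20,27,32), (0,17,24,8,39), (0,18,8,17,36),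
     (0,19,33,37,28), (0,20,29,34,37), (0,21,37,7,13), (0,22,15,6,35), (0,23,7,33,17), (0,24,35,18,8),
     (0,25,16,20,6), (0,27,22,10,40), (0,28,38,9,20), (0,30,26,11,18), (0,31,39,19,16), (0,32,17,40,19),
     (0,33,19,25,7), (0,34,9,24,41), (0,35,25,39,11), (0,36,14,29,30), (0,37,21,31,10), (0,38,11,22,31),
     (0,39,31,13,25), (0,40,27,12,23), (0,41,13,21,29), (1,6,20,40,15), (1,8,29,21,41), (1,10,35,25,14),
     (1,11,16,35,38), (1,12,38,34,27), (1,14,11,39,35), (1,16,23,7,26), (1,17,28,23,32), (1,18,7,37,30),
     (1,19,31,24,6), (1,20,26,32,40), (1,21,9,30,16), (1,22,40,26,33), (1,23,33,16,7), (1,24,32,22,9),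
     (1,26,17,33,23), (1,28,41,13,8), (1,29,10,41,20), (1,30,25,19,36), (1,32,14,38,22), (1,33,27,36,10),
     (1,34,22,14,39), (1,35,39,10,25), (1,38,8,20,34), (1,39,15,18,28), (1,40,34,8,21), (1,41,21,28,13),
     (2,6,34,17,40), (2,7,14,28,23), (2,10,38,19,29), (2,12,22,29,34), (2,13,26,10,41), (2,18,17,8,31),
     (2,19,9,35,13), (2,20,10,13,38), (2,21,35,39,24), (2,23,39,9,15), (2,24,40,11,22), (2,30,11,26,37),
     (2,31,27,41,7), (2,32,28,7,20), (2,33,41,21,12), (2,35,21,27,9), (2,36,29,14,19), (2,37,15,23,25),
     (2,38,16,25,32), (2,39,23,33,6), (2,41,33,15,27), (3,8,22,36,17), (3,14,40,30,29), (3,19,35,12,9),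
     (3,20,9,39,32), (3,21,33,26,8), (3,22,28,34,36), (3,23,11,32,12), (3,26,34,18,11), (3,31,41,6,27),
     (3,32,27,21,38), (3,34,16,40,18), (3,35,29,38,6), (3,37,23,24,15), (3,40,10,22,30), (3,41,17,20,24),
     (4,6,40,21,25), (4,9,16,24,19), (4,15,28,6,37), (4,19,41,11,17), (4,21,11,31,15), (4,31,23,29,11),
     (4,33,29,37,9), (4,37,35,17,29), (4,39,17,19,27), (5,22,11,41,34), (5,23,35,28,10), (5,34,29,23,40)
    ]"
  by code_simp

lemma starter6_8: "starter6 7 8
    [
     (0,6,33,15,41), (0,7,27,35,12), (0,8,44,38,30), (0,9,31,26,46), (0,10,36,45,16), (0,11,22,46,25),
     (0,12,21,27,35), (0,13,9,23,24), (0,14,46,32,18), (0,15,19,8,42), (0,16,30,47,28), (0,17,40,42,7),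
     (0,18,35,29,38), (0,19,7,30,47), (0,20,17,34,11), (0,21,38,24,33), (0,22,16,7,31), (0,23,47,39,14),
     (0,24,39,9,23), (0,25,15,41,6), (0,26,42,20,36), (0,27,37,14,44), (0,28,18,43,10), (0,29,34,44,13),
     (0,30,41,17,20), (0,31,25,36,45), (0,32,11,40,29), (0,33,20,12,39), (0,34,10,25,37), (0,35,45,21,8),
     (0,36,23,11,32), (0,37,13,18,43), (0,38,29,22,17), (0,39,32,6,21), (0,40,28,13,19), (0,41,43,33,26),
     (0,42,26,31,9), (0,44,8,19,15), (0,46,14,37,27), (1,7,28,40,15), (1,8,15,37,26), (1,9,22,29,34),
     (1,10,43,14,21), (1,11,23,30,24), (1,13,10,34,27), (1,14,27,31,8), (1,15,40,11,22), (1,16,45,26,39),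
     (1,17,41,18,6), (1,18,32,10,37), (1,19,8,38,28), (1,21,42,27,7), (1,22,17,44,30), (1,23,25,43,41),
     (1,25,16,22,9), (1,26,9,19,14), (1,27,34,17,40), (1,28,47,8,33), (1,29,35,36,12), (1,30,38,28,19),
     (1,31,26,20,16), (1,33,46,15,25), (1,34,11,42,36), (1,35,13,47,23), (1,36,20,16,31), (1,37,14,32,10),
     (1,39,44,9,13), (1,40,29,46,18), (1,41,7,45,35), (1,42,21,12,38), (1,44,39,24,32), (1,46,33,6,20),
     (2,6,38,47,12), (2,8,35,17,37), (2,9,29,31,14), (2,10,46,40,32), (2,11,33,28,42), (2,12,32,43,24),
     (2,14,23,29,31), (2,15,11,19,26), (2,16,42,34,20), (2,17,21,10,44), (2,19,43,41,16), (2,21,9,32,43),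
     (2,23,40,26,35), (2,24,20,45,6), (2,26,41,11,19), (2,27,17,37,8), (2,28,44,22,38), (2,29,39,16,46),
     (2,31,47,23,10), (2,33,27,38,47), (2,35,22,14,41), (2,37,45,35,28), (2,39,15,20,45), (2,41,34,8,23),
     (2,42,16,39,29), (2,44,28,33,11), (2,46,10,21,17), (3,6,45,16,23), (3,10,17,39,28), (3,12,47,28,41),
     (3,16,29,33,10), (3,19,27,45,37), (3,20,34,6,39), (3,21,10,40,24), (3,23,44,29,9), (3,24,43,10,35),
     (3,28,11,21,16), (3,31,15,43,19), (3,32,40,24,21), (3,33,28,22,12), (3,35,42,17,27), (3,37,9,47,31),
     (3,38,22,12,33), (3,39,16,34,6), (3,41,46,11,15), (3,42,35,8,22), (3,44,23,14,40), (3,46,41,26,34),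
     (4,6,42,36,34), (4,7,35,24,44), (4,8,40,43,14), (4,12,44,30,22), (4,13,23,6,46), (4,14,34,45,26),
     (4,21,45,37,12), (4,23,11,34,45), (4,24,46,18,40), (4,25,41,12,42), (4,26,22,47,8), (4,33,43,19,6),
     (4,35,29,40,43), (4,39,47,31,24), (4,41,17,22,47), (5,8,47,12,19), (5,14,43,24,37), (5,19,46,25,11),
     (5,21,29,47,39), (5,26,45,6,31), (5,31,44,13,29), (5,33,17,45,21), (5,37,42,7,17), (5,39,11,43,33)
    ]"
  by code_simp

text \<open>Exchanging men and women permutes these six games.\<close>

lemma starter_5: "starter 5
    [
     (3,7,12,10), (4,13,11,8), (5,9,6,14), (7,3,10,12), (8,11,13,4), (9,5,14,6)
    ]"
  by code_simp

lemma starter_7: "starter 7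
    [
     (3,12,20,11), (4,15,7,13), (5,8,14,19), (6,3,12,10), (8,18,16,5), (9,16,13,7), (10,14,15,20),
     (11,4,18,17), (17,9,19,6)
    ]"
  by code_simp

lemma starter_9: "starter 9
    [
     (3,16,24,13), (4,25,23,8), (5,9,18,26), (6,11,21,20), (7,15,12,22), (8,23,25,4), (9,5,26,18),
     (10,19,14,17), (11,6,20,21), (13,24,16,3), (15,7,22,12), (17,14,19,10)
    ]"
  by code_simp

lemma starter_11: "starter 11
    [
     (3,31,25,23), (4,12,23,16), (5,24,32,9), (6,20,27,17), (7,32,9,25), (8,11,15,27), (10,14,30,4),
     (11,28,26,7), (12,30,21,3), (13,15,20,29), (14,19,31,21), (16,22,19,13), (17,8,22,18), (18,6,29,26),
     (24,10,28,5)
    ]"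
  by code_simp

lemma starter_13: "starter 13
    [
     (3,26,36,17), (4,37,21,18), (5,34,7,38), (6,33,13,28), (8,31,35,10), (9,30,25,16), (10,35,31,8),
     (11,22,19,32), (12,20,27,23), (14,15,24,29), (15,14,29,24), (16,25,30,9), (17,36,26,3), (18,21,37,4),
     (20,12,23,27), (22,11,32,19), (28,13,33,6), (34,5,38,7)
    ]"
  by code_simp

lemma starter_15: "starter 15
    [
     (3,20,42,29), (4,14,23,16), (5,28,7,39), (6,22,39,25), (8,43,36,21), (9,24,41,4), (10,27,30,37),
     (11,12,38,33), (12,3,22,11), (13,34,20,17), (14,41,35,8), (15,10,37,18), (16,44,31,5), (17,23,27,7),
     (18,40,32,26), (19,15,28,30), (21,9,24,36), (25,38,33,42), (26,31,43,35), (29,32,34,13), (40,6,44,19)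
    ]"
  by code_simp

lemma starter_17: "starter 17
    [
     (3,48,32,23), (4,38,17,49), (5,40,50,13), (6,28,25,45), (7,46,42,9), (8,21,47,30), (9,42,46,7),
     (10,15,43,36), (11,12,39,44), (12,11,44,39), (13,5,40,50), (14,41,18,33), (15,43,36,10), (16,37,26,29),
     (19,27,34,24), (20,31,22,35), (21,47,30,8), (23,32,48,3), (24,19,27,34), (28,6,45,25), (29,26,37,16),
     (31,20,35,22), (33,18,41,14), (38,4,49,17)
    ]"
  by code_simp

lemma starter_19: "starter 19
    [
     (3,21,54,36), (4,51,6,55), (5,56,22,37), (7,9,52,48), (8,53,31,28), (9,38,47,25), (10,3,49,54),
     (11,42,15,50), (12,45,44,17), (13,27,46,30), (14,34,48,23), (16,35,43,26), (17,44,45,12), (18,13,39,46),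
     (19,32,29,40), (20,41,33,24), (21,49,34,14), (23,18,38,39), (24,33,41,20), (25,47,36,10), (26,7,35,52),
     (27,43,30,16), (28,31,53,8), (32,19,40,29), (37,22,56,5), (42,11,50,15), (51,4,55,6)
    ]"
  by code_simp

lemma starter_21: "starter 21
    [
     (3,17,50,60), (4,61,26,41), (5,52,62,13), (6,38,57,29), (7,42,21,58), (8,59,34,31), (9,5,54,62),
     (10,51,12,55), (11,56,22,43), (13,44,52,23), (14,53,36,27), (15,48,46,19), (16,54,49,9), (17,3,60,50),
     (18,37,28,45), (19,46,48,15), (20,57,47,6), (23,25,44,40), (24,35,32,39), (25,20,40,47), (27,36,53,14),
     (29,30,38,33), (30,16,33,49), (31,34,59,8), (35,24,39,32), (37,18,45,28), (41,26,61,4), (42,7,58,21),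
     (43,22,56,11), (51,10,55,12)
    ]"
  by code_simp

lemma starter_23: "starter 23
    [
     (3,68,40,30), (4,67,45,24), (5,22,68,49), (6,11,62,63), (7,64,29,44), (8,37,65,34), (9,60,56,17),
     (10,57,61,12), (11,6,63,62), (12,41,57,32), (13,27,42,58), (14,59,19,52), (15,10,54,61), (16,53,20,55),
     (17,56,60,9), (18,65,51,8), (21,48,35,38), (22,50,39,31), (23,66,50,3), (24,45,67,4), (25,36,33,46),
     (26,54,47,15), (27,13,58,42), (28,47,43,26), (30,40,49,23), (31,39,66,5), (32,51,41,18), (34,43,37,28),
     (36,25,46,33), (38,35,48,21), (44,29,64,7), (52,19,59,14), (53,16,55,20)
    ]"
  by code_simp

lemma starter_25: "starter 25
    [
     (3,50,29,72), (4,36,73,39), (5,74,46,31), (6,69,55,22), (7,9,66,70), (8,58,71,19), (9,7,70,66),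
     (10,15,67,60), (11,68,12,63), (13,51,24,64), (14,45,65,30), (15,67,60,10), (16,32,47,61), (17,62,52,25),
     (18,41,38,57), (19,26,58,53), (20,59,27,48), (21,4,54,73), (22,55,69,6), (23,33,42,56), (25,52,62,17),
     (26,34,53,43), (28,54,49,21), (30,14,45,65), (31,46,74,5), (32,16,61,47), (33,23,56,42), (34,8,43,71),
     (35,44,40,37), (36,28,39,49), (37,40,44,35), (41,18,57,38), (48,27,59,20), (50,3,72,29), (51,13,64,24),
     (63,12,68,11)
    ]"
  by code_simp

lemma starter_27: "starter 27
    [
     (3,78,68,17), (4,66,15,79), (5,49,80,34), (6,75,32,53), (7,36,45,76), (8,10,77,73), (9,58,25,72),
     (10,51,73,30), (11,74,64,19), (12,8,69,77), (13,69,47,37), (14,71,43,40), (16,26,67,59), (17,68,78,3),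
     (18,16,63,67), (19,64,74,11), (20,63,21,61), (22,47,61,38), (23,62,57,24), (24,57,62,23), (26,39,59,42),
     (27,50,35,54), (28,55,48,33), (29,20,56,65), (30,5,51,80), (31,44,41,52), (33,48,55,28), (34,29,49,56),
     (36,7,76,45), (37,21,46,60), (38,46,70,12), (39,13,42,70), (40,43,71,14), (44,31,52,41), (50,27,54,35),
     (53,32,75,6), (58,9,72,25), (60,22,65,18), (66,4,79,15)
    ]"
  by code_simp

lemma starter_29: "starter 29
    [
     (3,25,64,84), (4,85,62,29), (5,28,86,61), (6,23,81,68), (7,36,51,82), (8,83,75,12), (9,55,34,78),
     (10,26,79,65), (11,80,63,24), (12,75,83,8), (13,17,76,74), (14,39,48,77), (15,72,37,52), (16,66,21,73),
     (17,69,74,18), (18,58,69,31), (19,32,59,70), (20,71,22,67), (23,13,68,76), (24,63,80,11), (25,3,84,64),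
     (26,33,65,54), (27,47,44,60), (28,81,61,6), (29,62,85,4), (30,57,41,50), (31,38,58,53), (32,19,70,59),
     (33,10,54,79), (35,56,46,43), (36,7,82,51), (38,40,53,49), (39,14,77,48), (40,45,49,42), (42,5,45,86),
     (43,46,56,35), (47,27,60,44), (50,41,57,30), (52,37,72,15), (55,9,78,34), (66,16,73,21), (67,22,71,20)
    ]"
  by code_simp

text \<open>A patterned starter in both sexes: each game sets the man \<open>a\<close> against
  \<open>-a\<close> and the woman \<open>b\<close> against \<open>-b\<close>. Same-sex differences
  are then doubles of points, and doubling permutes a group of odd order.\<close>

lemma starter_31: "starter 31
    [
     (3,71,90,25), (4,44,92,52), (5,87,91,6), (6,47,87,49), (7,86,89,10), (8,81,88,12), (9,63,84,30),
     (10,21,86,72), (11,62,85,34), (12,92,81,4), (13,77,83,19), (14,69,82,24), (15,8,78,88), (16,20,80,76),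
     (17,65,79,31), (18,33,75,60), (19,42,77,51), (20,29,76,67), (21,54,72,39), (22,79,74,17), (23,18,73,75),
     (24,89,69,7), (25,59,71,37), (26,45,70,48), (27,50,66,46), (28,53,68,43), (29,41,67,55), (30,14,63,82),
     (31,38,65,58), (32,35,64,61), (33,70,60,26), (34,28,62,68), (35,22,61,74), (36,66,57,27), (37,84,59,9),
     (38,56,58,40), (39,91,54,5), (40,16,56,80), (41,85,55,11), (42,15,51,78), (43,64,53,32), (44,36,52,57),
     (45,13,48,83), (46,3,50,90), (47,73,49,23)
    ]"
  by code_simp

lemma starter_33: "starter 33
    [
     (3,96,58,43), (4,12,87,97), (5,76,98,25), (6,93,20,83), (7,47,94,56), (8,24,75,95), (9,50,90,53),
     (10,91,38,65), (11,55,46,92), (12,4,97,87), (13,88,21,78), (14,18,89,81), (15,29,74,84), (16,85,77,26),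
     (17,66,86,33), (18,89,81,14), (19,35,68,82), (22,59,44,79), (23,63,80,36), (24,8,95,75), (25,57,76,42),
     (26,77,85,16), (27,23,72,80), (28,73,60,39), (29,15,84,74), (30,69,34,67), (31,98,70,5), (32,51,48,71),
     (33,61,66,40), (35,19,82,68), (36,7,63,94), (37,41,62,64), (39,60,73,28), (40,90,61,9), (41,37,64,62),
     (42,86,57,17), (43,58,96,3), (45,54,52,49), (47,70,56,31), (49,52,54,45), (50,72,53,27), (51,32,71,48),
     (55,11,92,46), (59,22,79,44), (65,38,91,10), (67,34,69,30), (78,21,88,13), (83,20,93,6)
    ]"
  by code_simp

lemma starter_35: "starter 35
    [
     (3,102,32,77), (4,87,103,18), (5,61,46,104), (6,59,99,50), (7,66,39,100), (8,101,19,88), (9,103,96,4),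
     (10,97,68,41), (11,96,78,28), (12,93,16,91), (13,48,57,94), (14,40,95,67), (15,92,37,69), (17,99,92,6),
     (18,83,87,26), (20,21,84,89), (21,20,89,84), (22,85,45,60), (23,56,86,53), (24,31,76,81), (25,82,35,74),
     (26,37,83,70), (27,79,98,9), (28,95,79,14), (29,80,42,63), (30,64,75,43), (31,24,81,76), (33,44,65,72),
     (34,11,73,98), (36,62,69,47), (38,52,55,71), (40,78,67,27), (41,68,97,10), (43,86,64,23), (44,33,72,65),
     (47,15,62,90), (48,13,94,57), (49,58,54,51), (50,75,59,30), (51,54,58,49), (52,38,71,55), (53,34,56,73),
     (60,45,85,22), (61,5,104,46), (63,42,80,29), (66,7,100,39), (70,36,90,17), (74,35,82,25), (77,32,102,3),
     (88,19,101,8), (91,16,93,12)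
    ]"
  by code_simp

lemma starter_37: "starter 37
    [
     (3,89,108,26), (4,60,51,109), (5,110,37,76), (6,105,80,35), (7,104,11,106), (8,58,107,55), (9,102,71,44),
     (10,45,103,66), (12,16,97,99), (13,100,54,57), (14,48,101,63), (15,22,96,91), (16,12,99,97),
     (17,98,90,21), (18,93,25,88), (19,8,94,107), (20,39,72,95), (21,90,98,17), (22,108,91,3), (23,67,46,92),
     (24,59,56,87), (26,33,89,78), (27,84,73,40), (28,75,36,85), (29,10,86,103), (30,81,53,62),
     (31,101,82,14), (32,70,43,83), (33,29,78,86), (34,65,50,79), (35,80,105,6), (38,96,77,15), (39,20,95,72),
     (40,73,84,27), (41,82,74,31), (42,61,69,52), (44,71,102,9), (45,19,66,94), (47,68,64,49), (48,41,63,74),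
     (49,64,68,47), (52,77,61,38), (55,42,58,69), (57,54,100,13), (59,24,87,56), (60,4,109,51), (62,53,81,30),
     (65,34,79,50), (67,23,92,46), (70,32,83,43), (75,28,85,36), (76,37,110,5), (88,25,93,18), (104,7,106,11)
    ]"
  by code_simp

lemma starter_39: "starter 39
    [
     (3,11,114,110), (4,115,23,98), (5,30,87,116), (6,111,13,106), (7,60,112,57), (8,63,54,113),
     (9,86,35,108), (10,109,45,72), (11,96,110,21), (12,67,105,52), (14,49,70,107), (15,7,102,112),
     (16,102,57,62), (17,104,69,48), (18,40,99,79), (19,100,92,29), (20,97,22,101), (21,38,96,83),
     (24,28,93,91), (25,42,75,94), (26,95,51,66), (27,80,41,90), (28,18,91,99), (29,92,100,19), (30,5,116,87),
     (31,114,88,3), (32,89,39,78), (33,84,55,64), (34,105,85,12), (36,85,81,34), (37,82,77,44), (38,81,67,53),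
     (40,65,79,56), (42,25,94,75), (43,50,76,71), (44,77,82,37), (46,43,73,76), (47,58,61,74), (48,69,104,17),
     (49,14,107,70), (50,73,71,46), (52,68,83,36), (53,31,68,88), (56,103,65,16), (58,47,74,61),
     (59,24,62,93), (60,59,103,15), (63,8,113,54), (64,55,84,33), (66,51,95,26), (72,45,109,10),
     (78,39,89,32), (80,27,90,41), (86,9,108,35), (97,20,101,22), (98,23,115,4), (106,13,111,6)
    ]"
  by code_simp

lemma starter_41: "starter 41
    [
     (3,61,64,120), (4,121,83,44), (5,15,122,108), (6,23,117,104), (7,118,96,27), (8,100,25,119),
     (9,114,91,34), (10,87,36,115), (11,52,116,73), (12,41,86,111), (13,45,112,78), (14,113,79,46),
     (15,5,108,122), (16,54,69,109), (17,110,37,88), (18,95,32,105), (19,24,106,99), (20,107,94,31),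
     (21,102,58,67), (22,74,53,103), (23,6,104,117), (24,19,99,106), (26,101,63,60), (27,96,118,7),
     (28,92,35,97), (29,48,98,75), (30,85,93,40), (31,94,107,20), (33,38,90,89), (34,91,114,9), (38,33,89,90),
     (39,84,56,71), (40,93,85,30), (41,12,111,86), (42,68,81,59), (43,80,47,82), (44,83,121,4),
     (45,13,78,112), (46,79,113,14), (48,29,75,98), (49,76,72,51), (50,66,57,77), (51,72,76,49),
     (52,11,73,116), (54,16,109,69), (55,65,70,62), (59,81,68,42), (60,63,101,26), (61,3,120,64),
     (62,70,65,55), (66,50,77,57), (67,58,102,21), (71,56,84,39), (74,22,103,53), (80,43,82,47),
     (87,10,115,36), (88,37,110,17), (92,28,97,35), (95,18,105,32), (100,8,119,25)
    ]"
  by code_simp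

lemma starter_43: "starter 43
    [
     (3,122,126,10), (4,56,128,76), (5,81,127,48), (6,112,123,20), (7,33,125,96), (8,109,124,23),
     (9,25,120,107), (10,69,122,60), (11,13,121,119), (12,95,117,37), (13,89,119,43), (14,66,118,63),
     (15,127,114,5), (16,72,116,57), (17,64,115,68), (18,50,111,82), (19,26,113,106), (20,9,112,120),
     (21,84,108,45), (22,73,110,59), (23,53,109,79), (24,58,105,74), (25,3,107,126), (26,46,106,86),
     (27,108,102,21), (28,85,104,47), (29,113,103,19), (30,125,99,7), (31,128,101,4), (32,15,100,114),
     (33,32,96,100), (34,80,98,52), (35,117,97,12), (36,97,93,35), (37,18,95,111), (38,49,94,83),
     (39,27,90,102), (40,22,92,110), (41,62,91,70), (42,39,87,90), (43,103,89,29), (44,17,88,115),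
     (45,51,84,78), (46,55,86,77), (47,101,85,31), (48,116,81,16), (49,92,83,40), (50,6,82,123),
     (51,75,78,54), (52,88,80,44), (53,11,79,121), (54,87,75,42), (55,94,77,38), (56,41,76,91), (57,67,72,65),
     (58,93,74,36), (59,34,73,98), (60,118,69,14), (61,30,71,99), (62,124,70,8), (63,71,66,61),
     (64,104,68,28), (65,24,67,105)
    ]"
  by code_simp

lemma starter_45: "starter 45
    [
     (3,31,132,106), (4,133,41,98), (5,127,10,134), (6,91,129,46), (7,130,125,14), (8,103,34,131),
     (9,126,65,74), (11,124,128,13), (12,32,107,123), (13,128,124,11), (14,125,130,7), (15,120,56,83),
     (16,71,121,68), (17,57,78,122), (18,117,94,43), (19,110,118,29), (20,84,51,119), (21,70,67,114),
     (22,115,87,48), (23,79,116,58), (24,88,49,111), (25,112,38,101), (26,33,113,102), (27,108,80,59),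
     (28,60,75,109), (29,118,110,19), (30,105,61,76), (31,3,106,132), (32,12,123,107), (33,26,102,113),
     (35,104,90,45), (36,52,99,85), (37,96,39,100), (40,42,97,93), (42,40,93,97), (43,94,117,18),
     (44,72,63,95), (45,90,104,35), (46,129,91,6), (47,82,55,92), (48,87,115,22), (50,73,89,64),
     (52,36,85,99), (53,86,66,69), (54,62,81,77), (57,17,122,78), (58,116,79,23), (59,80,108,27),
     (60,28,109,75), (62,54,77,81), (64,89,73,50), (68,121,71,16), (69,66,86,53), (70,21,114,67),
     (72,44,95,63), (74,65,126,9), (76,61,105,30), (82,47,92,55), (83,56,120,15), (84,20,119,51),
     (88,24,111,49), (96,37,100,39), (98,41,133,4), (101,38,112,25), (103,8,131,34), (127,5,134,10)
    ]"
  by code_simp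

lemma starter_47: "starter 47
    [
     (3,138,74,71), (4,140,93,49), (5,27,140,114), (6,135,95,50), (7,106,136,37), (8,60,81,137),
     (9,124,19,132), (10,133,110,35), (11,93,134,48), (12,129,97,46), (13,29,116,130), (14,33,131,108),
     (15,128,122,22), (16,127,75,66), (17,57,128,84), (18,104,123,41), (20,125,115,28), (21,91,52,120),
     (22,18,121,123), (23,121,126,17), (24,136,117,7), (25,101,44,118), (26,119,102,39), (27,31,114,112),
     (28,115,125,20), (29,13,130,116), (30,65,80,111), (31,134,112,11), (32,113,63,78), (33,23,108,122),
     (34,96,45,109), (35,110,133,10), (36,86,59,105), (37,47,106,98), (38,107,43,100), (39,102,119,26),
     (40,77,68,103), (41,90,104,51), (42,89,99,56), (46,97,129,12), (47,67,98,76), (48,94,139,5),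
     (49,24,94,117), (50,95,135,6), (51,64,90,79), (53,92,55,88), (54,73,70,87), (56,61,89,82), (57,139,84,4),
     (58,85,83,62), (60,8,137,81), (61,99,82,42), (62,83,85,58), (64,72,79,69), (65,30,111,80),
     (66,75,127,16), (67,15,76,126), (69,131,72,14), (71,74,138,3), (73,54,87,70), (77,40,103,68),
     (78,63,113,32), (86,36,105,59), (88,55,92,53), (91,21,120,52), (96,34,109,45), (100,43,107,38),
     (101,25,118,44), (124,9,132,19)
    ]"
  by code_simp

lemma starter_49: "starter 49
    [
     (3,144,20,131), (4,116,145,35), (5,36,111,146), (6,141,40,109), (7,84,63,142), (8,46,143,103),
     (9,128,23,138), (10,139,15,132), (11,82,140,67), (12,58,135,91), (13,60,87,136), (14,137,75,72),
     (16,41,133,110), (17,34,115,134), (18,77,74,129), (19,21,130,126), (21,19,126,130), (22,127,42,105),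
     (24,123,49,100), (25,80,71,124), (26,106,125,43), (27,79,120,70), (28,121,114,33), (29,54,93,122),
     (30,53,117,98), (31,118,81,66), (32,39,108,119), (33,114,121,28), (34,17,134,115), (35,145,116,4),
     (36,5,146,111), (37,101,112,50), (38,113,64,85), (39,32,119,108), (41,16,110,133), (43,125,106,26),
     (44,102,45,107), (46,8,103,143), (47,104,88,61), (48,92,59,99), (50,112,101,37), (51,68,83,96),
     (52,97,69,78), (53,30,98,117), (54,29,122,93), (55,62,94,89), (56,95,90,57), (57,90,95,56),
     (58,12,91,135), (60,13,136,87), (61,88,104,47), (62,55,89,94), (65,76,86,73), (66,81,118,31),
     (67,140,82,11), (68,51,96,83), (70,120,79,27), (72,75,137,14), (73,86,76,65), (77,18,129,74),
     (78,69,97,52), (80,25,124,71), (84,7,142,63), (85,64,113,38), (92,48,99,59), (100,49,123,24),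
     (102,44,107,45), (105,42,127,22), (109,40,141,6), (128,9,138,23), (131,20,144,3), (132,15,139,10)
    ]"
  by code_simp

lemma starter_53: "starter 53
    [
     (3,79,82,156), (4,157,149,14), (5,144,158,15), (6,136,153,25), (7,154,107,56), (8,117,42,155),
     (9,150,53,110), (10,66,93,151), (11,34,152,127), (12,73,147,88), (13,138,21,148), (14,149,157,4),
     (15,158,144,5), (16,145,38,125), (17,19,142,146), (18,40,141,121), (19,17,146,142), (20,143,76,85),
     (22,139,114,45), (23,75,140,84), (24,92,71,135), (25,153,136,6), (26,137,63,96), (27,106,55,132),
     (28,78,133,81), (29,134,100,61), (30,104,129,59), (31,39,120,130), (32,131,94,67), (33,126,83,80),
     (34,11,127,152), (35,123,36,128), (37,44,124,119), (39,31,130,120), (40,18,121,141), (41,122,90,69),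
     (43,118,50,113), (44,37,119,124), (45,114,139,22), (46,60,99,115), (47,108,116,51), (48,91,111,70),
     (49,89,74,112), (51,116,108,47), (52,98,65,109), (54,68,105,95), (56,107,154,7), (57,86,77,102),
     (58,103,87,72), (59,129,104,30), (60,46,115,99), (61,100,134,29), (62,97,101,64), (64,101,97,62),
     (66,10,151,93), (67,94,131,32), (68,54,95,105), (69,90,122,41), (70,111,91,48), (72,87,103,58),
     (73,12,88,147), (75,23,84,140), (78,28,81,133), (79,3,156,82), (80,83,126,33), (85,76,143,20),
     (86,57,102,77), (89,49,112,74), (92,24,135,71), (96,63,137,26), (98,52,109,65), (106,27,132,55),
     (110,53,150,9), (113,50,118,43), (117,8,155,42), (123,35,128,36), (125,38,145,16), (138,13,148,21)
    ]"
  by code_simp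

lemma starter_63: "starter 63
    [
     (3,70,186,121), (4,78,20,91), (5,188,162,27), (6,109,136,185), (7,184,45,144), (8,166,185,25),
     (9,180,103,88), (10,18,171,181), (11,187,182,4), (12,177,59,134), (13,146,178,47), (14,39,150,179),
     (15,174,26,167), (16,182,175,11), (17,96,93,176), (18,10,181,171), (19,92,172,101), (21,43,148,168),
     (22,84,169,105), (23,170,126,63), (24,77,116,165), (25,178,166,13), (27,162,188,5), (28,89,102,136),
     (29,115,164,76), (30,143,50,159), (31,175,160,16), (32,161,66,123), (33,28,82,158), (34,157,153,36),
     (35,58,158,133), (36,153,157,34), (37,72,117,154), (38,52,155,139), (39,14,179,150), (40,137,151,56),
     (41,152,141,48), (42,128,147,65), (43,21,168,148), (44,149,85,106), (46,90,99,145), (47,112,146,79),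
     (48,141,152,41), (49,87,142,102), (51,40,138,151), (52,3,119,19), (53,140,108,81), (54,135,80,113),
     (55,8,183,82), (56,61,137,130), (57,62,131,132), (58,67,133,124), (60,129,95,98), (61,156,130,33),
     (62,57,132,131), (63,126,170,23), (64,107,86,127), (65,147,128,42), (67,38,124,155), (68,120,69,125),
     (70,110,121,83), (71,122,75,114), (72,37,154,117), (73,173,118,20), (74,172,139,186), (76,6,115,183),
     (77,24,165,116), (78,94,111,97), (79,138,92,73), (81,108,140,53), (83,49,110,142), (84,22,105,169),
     (87,55,163,104), (88,103,180,9), (89,31,104,160), (90,46,145,99), (91,74,100,119), (94,164,97,29),
     (96,17,176,93), (98,95,129,60), (101,118,112,51), (106,85,149,44), (107,64,127,86), (109,35,156,163),
     (113,80,135,54), (114,75,122,71), (120,68,125,69), (123,66,161,32), (134,59,177,12), (143,30,159,50),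
     (144,45,184,7), (167,26,174,15), (173,100,187,111)
    ]"
  by code_simp

lemma starter_65: "starter 65
    [
     (3,103,94,192), (4,108,193,87), (5,194,133,64), (6,189,124,73), (7,50,149,190), (8,42,191,153),
     (9,186,20,179), (10,95,187,104), (11,43,154,188), (12,86,113,183), (13,184,138,57), (14,28,185,169),
     (15,109,88,180), (16,181,170,29), (17,157,182,40), (18,106,177,91), (19,146,53,178), (21,174,143,56),
     (22,161,175,38), (23,150,45,176), (24,171,136,61), (25,63,172,132), (26,159,36,173), (27,55,142,168),
     (28,14,169,185), (29,170,181,16), (30,52,165,145), (31,166,75,120), (32,162,33,167), (34,84,163,111),
     (35,164,93,102), (37,160,129,66), (38,175,161,22), (39,156,148,49), (40,182,157,17), (41,118,79,158),
     (42,8,153,191), (43,11,188,154), (44,155,99,96), (46,151,110,89), (47,54,152,141), (48,131,147,68),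
     (49,148,156,39), (50,7,190,149), (51,144,71,128), (52,30,145,165), (54,47,141,152), (55,27,168,142),
     (56,143,174,21), (57,138,184,13), (58,134,65,139), (59,81,140,114), (60,107,92,135), (61,136,171,24),
     (62,72,137,123), (63,25,132,172), (64,133,194,5), (66,129,160,37), (67,116,83,130), (68,147,131,48),
     (69,100,97,126), (70,77,127,122), (72,62,123,137), (73,124,189,6), (74,76,121,125), (76,74,125,121),
     (77,70,122,127), (78,98,117,101), (80,119,115,82), (81,59,114,140), (82,115,119,80), (84,34,111,163),
     (85,112,105,90), (86,12,183,113), (87,193,108,4), (89,110,151,46), (90,105,112,85), (91,177,106,18),
     (95,10,104,187), (96,99,155,44), (98,78,101,117), (100,69,126,97), (102,93,164,35), (103,3,192,94),
     (107,60,135,92), (109,15,180,88), (116,67,130,83), (118,41,158,79), (120,75,166,31), (128,71,144,51),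
     (134,58,139,65), (146,19,178,53), (150,23,176,45), (159,26,173,36), (162,32,167,33), (179,20,186,9)
    ]"
  by code_simp

lemma starter_67: "starter 67
    [
     (3,56,198,148), (4,45,200,156), (5,60,199,141), (6,48,195,153), (7,101,197,103), (8,40,196,164),
     (9,163,192,41), (10,180,194,21), (11,135,193,66), (12,4,189,200), (13,82,191,122), (14,35,190,169),
     (15,70,186,134), (16,99,188,102), (17,24,187,177), (18,144,183,57), (19,119,185,85), (20,97,184,107),
     (21,158,180,46), (22,109,182,95), (23,194,181,10), (24,31,177,173), (25,78,179,123), (26,159,178,42),
     (27,86,174,118), (28,3,176,198), (29,138,175,63), (30,39,171,162), (31,197,173,7), (32,94,172,110),
     (33,161,168,43), (34,142,170,62), (35,74,169,130), (36,11,165,193), (37,100,167,104), (38,44,166,160),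
     (39,111,162,90), (40,143,164,61), (41,154,163,50), (42,155,159,49), (43,27,161,174), (44,36,160,165),
     (45,8,156,196), (46,72,158,129), (47,96,157,105), (48,183,153,18), (49,113,155,91), (50,190,154,14),
     (51,6,150,195), (52,32,152,172), (53,139,151,65), (54,30,147,171), (55,89,149,115), (56,151,148,53),
     (57,54,144,147), (58,71,146,133), (59,37,145,167), (60,17,141,187), (61,166,143,38), (62,5,142,199),
     (63,67,138,137), (64,175,140,29), (65,125,139,79), (66,185,135,19), (67,186,137,15), (68,114,136,87),
     (69,150,132,51), (70,149,134,55), (71,34,133,170), (72,92,129,112), (73,75,131,126), (74,33,130,168),
     (75,146,126,58), (76,120,128,81), (77,93,127,108), (78,121,123,83), (79,25,125,179), (80,116,124,88),
     (81,52,120,152), (82,12,122,189), (83,9,121,192), (84,69,117,132), (85,182,119,22), (86,145,118,59),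
     (87,73,114,131), (88,136,116,68), (89,191,115,13), (90,117,111,84), (91,80,113,124), (92,184,112,20),
     (93,176,108,28), (94,106,110,98), (95,77,109,127), (96,26,105,178), (97,64,107,140), (98,47,106,157),
     (99,76,102,128), (100,16,104,188), (101,23,103,181)
    ]"
  by code_simp

lemma starter_69: "starter 69
    [
     (3,194,204,17), (4,205,138,69), (5,154,55,206), (6,201,133,76), (7,56,202,155), (8,178,31,203),
     (9,97,198,112), (10,199,108,99), (11,157,52,200), (12,140,71,195), (13,117,196,90), (14,197,16,193),
     (15,182,29,192), (17,204,194,3), (18,70,189,139), (19,190,180,27), (20,87,120,191), (21,43,186,166),
     (22,187,51,156), (23,100,109,188), (24,137,74,183), (25,53,184,158), (26,185,91,118), (27,180,190,19),
     (28,30,181,177), (30,28,177,181), (32,179,160,49), (33,64,145,174), (34,175,150,57), (35,79,176,130),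
     (36,171,170,41), (37,102,105,172), (38,126,173,81), (39,134,168,77), (40,114,93,169), (41,170,171,36),
     (42,152,59,165), (43,21,166,186), (44,167,136,73), (45,110,162,101), (46,163,54,153), (47,78,129,164),
     (48,121,159,88), (49,160,179,32), (50,132,75,161), (53,25,158,184), (56,7,155,202), (57,150,175,34),
     (58,68,151,143), (60,147,67,142), (61,116,148,95), (62,85,124,149), (63,144,98,113), (64,33,174,145),
     (65,103,146,106), (66,83,128,141), (68,58,143,151), (69,138,205,4), (70,18,139,189), (72,86,135,125),
     (73,136,167,44), (76,133,201,6), (77,168,134,39), (78,47,164,129), (79,35,130,176), (80,131,115,94),
     (81,173,126,38), (82,127,122,89), (83,66,141,128), (84,123,104,107), (85,62,149,124), (86,72,125,135),
     (87,20,191,120), (88,159,121,48), (89,122,127,82), (90,196,117,13), (92,96,111,119), (94,115,131,80),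
     (95,148,116,61), (96,92,119,111), (97,9,112,198), (99,108,199,10), (100,23,188,109), (101,162,110,45),
     (102,37,172,105), (103,65,106,146), (107,104,123,84), (113,98,144,63), (114,40,169,93), (118,91,185,26),
     (132,50,161,75), (137,24,183,74), (140,12,195,71), (142,67,147,60), (152,42,165,59), (153,54,163,46),
     (154,5,206,55), (156,51,187,22), (157,11,200,52), (178,8,203,31), (182,15,192,29), (193,16,197,14)
    ]"
  by code_simp

lemma starter_73: "starter 73
    [
     (3,12,216,207), (4,120,218,99), (5,177,217,42), (6,26,213,196), (7,64,215,158), (8,51,214,168),
     (9,93,210,126), (10,3,212,216), (11,16,211,206), (12,128,207,94), (13,36,209,183), (14,143,208,79),
     (15,19,204,203), (16,103,206,119), (17,86,205,136), (18,149,201,73), (19,41,203,181), (20,68,202,154),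
     (21,162,198,57), (22,161,200,61), (23,6,199,213), (24,96,195,123), (25,84,197,135), (26,102,196,117),
     (27,108,192,111), (28,60,194,159), (29,204,193,15), (30,75,189,144), (31,104,191,118), (32,165,190,54),
     (33,167,186,55), (34,116,188,106), (35,32,187,190), (36,153,183,66), (37,218,185,4), (38,146,184,76),
     (39,140,180,82), (40,53,182,169), (41,209,181,13), (42,107,177,115), (43,72,179,147), (44,7,178,215),
     (45,8,174,214), (46,38,176,184), (47,23,175,199), (48,194,171,28), (49,67,173,155), (50,189,172,30),
     (51,18,168,201), (52,171,170,48), (53,43,169,179), (54,217,165,5), (55,21,167,198), (56,131,166,91),
     (57,212,162,10), (58,89,164,133), (59,65,163,157), (60,152,159,70), (61,9,161,210), (62,166,160,56),
     (63,124,156,98), (64,174,158,45), (65,46,157,176), (66,109,153,113), (67,78,155,141), (68,142,154,80),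
     (69,129,150,90), (70,197,152,25), (71,59,151,163), (72,87,147,132), (73,24,149,195), (74,121,148,101),
     (75,139,144,83), (76,130,146,92), (77,127,145,95), (78,172,141,50), (79,52,143,170), (80,151,142,71),
     (81,180,138,39), (82,137,140,85), (83,27,139,192), (84,58,135,164), (85,178,137,44), (86,122,136,100),
     (87,74,132,148), (88,200,134,22), (89,110,133,112), (90,208,129,14), (91,186,131,33), (92,34,130,188),
     (93,11,126,211), (94,191,128,31), (95,125,127,97), (96,134,123,88), (97,69,125,150), (98,35,124,187),
     (99,77,120,145), (100,205,122,17), (101,62,121,160), (102,37,117,185), (103,173,119,49),
     (104,81,118,138), (105,63,114,156), (106,202,116,20), (107,193,115,29), (108,40,111,182),
     (109,175,113,47), (110,105,112,114)
    ]"
  by code_simp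

lemma frames_6: "uniform_frame 6 5" "uniform_frame 6 6" "uniform_frame 6 7" "uniform_frame 6 8"
  using starter6_5[THEN starter6_imp_frame] starter6_6[THEN starter6_imp_frame] starter6_7[THEN starter6_imp_frame] starter6_8[THEN starter6_imp_frame] by simp_all

text \<open>These are the values that the recursion leaves out. Six groups of size 5 reach 25 to 30
  except 26, which would keep a single point in one group; eight groups of size 7 start at 35 and
  for the same reason miss 36.\<close>

lemma base_frames:
  fixes u :: nat
  assumes "2 \<le> u" "u \<le> 24 \<or> u = 26 \<or> u = 31 \<or> u = 32 \<or> u = 33 \<or> u = 34 \<or> u = 36"
  shows "uniform_frame 3 (2 * u + 1)"
proof -
  have "u \<in> {2, 3, 4, 5, 6, 7, 8, 9, 10, 11, 12, 13, 14, 15, 16, 17, 18, 19, 20, 21, 22, 23, 24, 26, 31, 32, 33, 34, 36}"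
    using assms by (simp, presburger)
  then show ?thesis
    using starter_5[THEN starter_imp_frame] starter_7[THEN starter_imp_frame] starter_9[THEN starter_imp_frame]
      starter_11[THEN starter_imp_frame] starter_13[THEN starter_imp_frame] starter_15[THEN starter_imp_frame]
      starter_17[THEN starter_imp_frame] starter_19[THEN starter_imp_frame] starter_21[THEN starter_imp_frame]
      starter_23[THEN starter_imp_frame] starter_25[THEN starter_imp_frame] starter_27[THEN starter_imp_frame]
      starter_29[THEN starter_imp_frame] starter_31[THEN starter_imp_frame] starter_33[THEN starter_imp_frame]
      starter_35[THEN starter_imp_frame] starter_37[THEN starter_imp_frame] starter_39[THEN starter_imp_frame]
      starter_41[THEN starter_imp_frame] starter_43[THEN starter_imp_frame] starter_45[THEN starter_imp_frame]
      starter_47[THEN starter_imp_frame] starter_49[THEN starter_imp_frame] starter_53[THEN starter_imp_frame]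
      starter_63[THEN starter_imp_frame] starter_65[THEN starter_imp_frame] starter_67[THEN starter_imp_frame]
      starter_69[THEN starter_imp_frame] starter_73[THEN starter_imp_frame]
    by auto
qed

section \<open>Tournaments from frames with holes of size three\<close>

text \<open>The four games of a CMDRR(3, 1), as man, man, partner of the first man, partner of the second man. Each point of
  a hole hosts one of the first three games in its round; the last game goes to the short round.\<close>

definition local_game :: "nat \<Rightarrow> nat list" where
  "local_game k = [[0, 1, 1, 2], [0, 2, 2, 1], [1, 2, 0, 2], [1, 2, 1, 0]] ! k"

text \<open>A key names a game either by a frame tuple or by a hole and the index of a local game.
  Counting in a list of games thus becomes the cardinality of a set of keys.\<close>

type_synonym key = "(nat \<times> nat) list + nat \<times> nat"

definition mem :: "key \<Rightarrow> nat \<Rightarrow> nat \<times> nat" where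
  "mem \<kappa> r = (case \<kappa> of Inl t \<Rightarrow> t ! r | Inr (i, k) \<Rightarrow> (i, local_game k ! r))"

definition swap_col :: "nat \<Rightarrow> nat" where
  "swap_col r = [1, 0, 3, 2, 4] ! r"

lemma swap5_nth: "r < 5 \<Longrightarrow> swap5 t ! r = t ! swap_col r"
  unfolding nat_less_5_cases by (auto simp: swap5_def swap_col_def)

lemma card_Inr_image: "card (Inr ` A :: ('a + 'b) set) = card A"
  by (simp add: card_image inj_on_def)

lemma distinct_concat_map:
  assumes "distinct ks" "\<And>k. k \<in> set ks \<Longrightarrow> distinct (f k)"
    "\<And>k l. k \<in> set ks \<Longrightarrow> l \<in> set ks \<Longrightarrow> k \<noteq> l \<Longrightarrow> set (f k) \<inter> set (f l) = {}"
  shows "distinct (concat (map f ks))"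
  using assms
proof (induction ks)
  case (Cons a ks)
  then have "distinct (concat (map f ks))" by simp
  moreover have "set (f a) \<inter> set (f k) = {}" if "k \<in> set ks" for k
    using Cons.prems(1,3) that by auto
  ultimately show ?case using Cons.prems(2) by auto
qed simp

lemma length_filter_map_card:
  assumes "distinct L"
  shows "length (filter \<phi> (map g L)) = card {\<kappa> \<in> set L. \<phi> (g \<kappa>)}"
proof -
  have "length (filter \<phi> (map g L)) = length (filter (\<lambda>\<kappa>. \<phi> (g \<kappa>)) L)"
    by (simp add: filter_map comp_def)
  also have "\<dots> = card (set (filter (\<lambda>\<kappa>. \<phi> (g \<kappa>)) L))"
    using assms by (intro distinct_card[symmetric] distinct_filter)
  finally show ?thesis by simp
qed

lemma less_3_cases: "(a :: nat) < 3 \<longleftrightarrow> a = 0 \<or> a = 1 \<or> a = 2"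
  by auto

locale triple_frame =
  fixes n :: nat and Q :: "(nat \<times> nat) list set"
  assumes frame: "hframe ({..<n} \<times> {..<3}) fst Q" and odd: "odd n"
begin

section \<open>Numbering of the players and the set of games\<close>

abbreviation "P \<equiv> {..<n} \<times> {..<3 :: nat}"

text \<open>The points with second coordinate 0 receive the numbers below \<open>n\<close>. So the
  fixed spouse labelling marries man and woman at one point of every hole.\<close>

definition num :: "nat \<times> nat \<Rightarrow> nat" where
  "num p = snd p * n + fst p"

definition pt :: "nat \<Rightarrow> nat \<times> nat" where
  "pt x = (x mod n, x div n)"

lemma n_pos: "n > 0"
  using odd by (cases n) auto

lemma pt_num: "p \<in> P \<Longrightarrow> pt (num p) = p"
  unfolding pt_def num_def using n_pos by (cases p) auto

lemma pt_in: "x < 3 * n \<Longrightarrow> pt x \<in> P"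
  unfolding pt_def using n_pos by (auto simp: less_mult_imp_div_less)

lemma num_pt: "num (pt x) = x"
  unfolding pt_def num_def by simp

lemma num_less: "p \<in> P \<Longrightarrow> num p < 3 * n"
proof -
  assume "p \<in> P"
  then obtain i j where "p = (i, j)" "i < n" "j = 0 \<or> j = 1 \<or> j = 2"
    by (cases p) (auto simp: less_3_cases)
  then show "num p < 3 * n" unfolding num_def by auto
qed

lemma num_eq_iff: "p \<in> P \<Longrightarrow> q \<in> P \<Longrightarrow> num p = num q \<longleftrightarrow> p = q"
  by (metis pt_num)

lemma num_eq_pt_iff: "p \<in> P \<Longrightarrow> x < 3 * n \<Longrightarrow> num p = x \<longleftrightarrow> p = pt x"
  by (metis pt_num num_pt)

lemma num_less_n: "p \<in> P \<Longrightarrow> num p < n \<longleftrightarrow> snd p = 0"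
  unfolding num_def by (cases p, cases "snd p") auto

text \<open>\<open>Q\<close> contains every game under both orders of its teams; comparing the
  numbers of the two men selects one of them.\<close>

definition H :: "(nat \<times> nat) list set" where
  "H = {t \<in> Q. num (t ! 0) < num (t ! 1)}"

definition keys :: "key set" where
  "keys = Inl ` H \<union> Inr ` ({..<n} \<times> {..<4})"

definition game_of :: "key \<Rightarrow> game" where
  "game_of \<kappa> = ((num (mem \<kappa> 0), num (mem \<kappa> 2)), (num (mem \<kappa> 1), num (mem \<kappa> 3)))"

lemma H_swap: "t \<in> Q \<Longrightarrow> t \<in> H \<longleftrightarrow> swap5 t \<notin> H"
proof -
  assume t: "t \<in> Q"
  then have "fst (t ! 0) \<noteq> fst (t ! 1)" "t ! 0 \<in> P" "t ! 1 \<in> P"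
    using hframe_nth_hole_neq[OF frame t, of 0 1] hframe_nth_in[OF frame t] by auto
  then have "num (t ! 0) \<noteq> num (t ! 1)" using num_eq_iff by metis
  moreover have "swap5 t \<in> Q" using hframeD(5)[OF frame t] .
  ultimately show ?thesis using t unfolding H_def by (auto simp: swap5_def)
qed

lemma local_game_less: "k < 4 \<Longrightarrow> r < 4 \<Longrightarrow> local_game k ! r < 3"
  unfolding local_game_def by (auto simp: less_Suc_eq eval_nat_numeral)

lemma mem_in: "\<kappa> \<in> keys \<Longrightarrow> r < 4 \<Longrightarrow> mem \<kappa> r \<in> P"
  unfolding keys_def using hframe_nth_in[OF frame] local_game_less
  by (auto simp: H_def mem_def mem_Times_iff)

text \<open>The frame gives one tuple of \<open>Q\<close>, and exactly one of this tuple and its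
  swap lies in \<open>H\<close>. The swap shows the same points in the exchanged columns, hence the
  disjunction.\<close>

lemma half_ex1:
  assumes ab: "\<alpha> < 5" "\<beta> < 5" "\<alpha> \<noteq> \<beta>" and pq: "p \<in> P" "q \<in> P" "fst p \<noteq> fst q"
  shows "\<exists>!t. t \<in> H \<and> (t ! \<alpha> = p \<and> t ! \<beta> = q \<or> t ! swap_col \<alpha> = p \<and> t ! swap_col \<beta> = q)"
proof -
  obtain t where t: "t \<in> Q" "t ! \<alpha> = p" "t ! \<beta> = q"
    and un: "\<And>t'. t' \<in> Q \<Longrightarrow> t' ! \<alpha> = p \<Longrightarrow> t' ! \<beta> = q \<Longrightarrow> t' = t"
    using hframe_ex1[OF frame ab pq] by metis
  have sw: "swap5 t \<in> Q" "swap5 (swap5 t) = t"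
    using hframeD(2,5)[OF frame t(1)] swap5_swap5 by auto
  have un2: "s = t \<or> s = swap5 t"
    if "s \<in> Q" "s ! \<alpha> = p \<and> s ! \<beta> = q \<or> s ! swap_col \<alpha> = p \<and> s ! swap_col \<beta> = q" for s
  proof -
    have "swap5 s \<in> Q" "swap5 (swap5 s) = s"
      using hframeD(2,5)[OF frame that(1)] swap5_swap5 by auto
    then show ?thesis using that un[of s] un[of "swap5 s"] ab by (auto simp: swap5_nth)
  qed
  have tt: "t ! \<alpha> = p \<and> t ! \<beta> = q" "swap5 t ! swap_col \<alpha> = p \<and> swap5 t ! swap_col \<beta> = q"
    using t ab swap5_nth[of \<alpha> "swap5 t"] swap5_nth[of \<beta> "swap5 t"] sw by auto
  show ?thesis
  proof (cases "t \<in> H")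
    case True
    then have "swap5 t \<notin> H" using H_swap t by blast
    then show ?thesis using True tt un2 by (intro ex1I[of _ t]) (auto simp: H_def)
  next
    case False
    then have "swap5 t \<in> H" using H_swap t by blast
    then show ?thesis using False tt un2 by (intro ex1I[of _ "swap5 t"]) (auto simp: H_def)
  qed
qed

section \<open>Counting the encounters of two players\<close>

definition occ :: "nat \<Rightarrow> nat \<Rightarrow> nat \<times> nat \<Rightarrow> nat \<times> nat \<Rightarrow> key set" where
  "occ \<alpha> \<beta> p q = {\<kappa> \<in> keys. mem \<kappa> \<alpha> = p \<and> mem \<kappa> \<beta> = q \<or> mem \<kappa> (swap_col \<alpha>) = p \<and> mem \<kappa> (swap_col \<beta>) = q}"

text \<open>Local games stay inside one hole, so only frame games join points of different holes,
  and \<open>half_ex1\<close> leaves exactly one.\<close>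

lemma card_occ_diff:
  assumes ab: "\<alpha> < 5" "\<beta> < 5" "\<alpha> \<noteq> \<beta>" and pq: "p \<in> P" "q \<in> P" "fst p \<noteq> fst q"
  shows "card (occ \<alpha> \<beta> p q) = 1"
proof -
  obtain t where t: "t \<in> H" "t ! \<alpha> = p \<and> t ! \<beta> = q \<or> t ! swap_col \<alpha> = p \<and> t ! swap_col \<beta> = q"
    and un: "\<And>s. s \<in> H \<Longrightarrow> s ! \<alpha> = p \<and> s ! \<beta> = q \<or> s ! swap_col \<alpha> = p \<and> s ! swap_col \<beta> = q \<Longrightarrow> s = t"
    using half_ex1[OF assms] by metis
  have "\<kappa> \<in> occ \<alpha> \<beta> p q \<longleftrightarrow> \<kappa> = Inl t" for \<kappa>
  proof (cases \<kappa>)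
    case (Inl s)
    then have "\<kappa> \<in> occ \<alpha> \<beta> p q \<longleftrightarrow>
        s \<in> H \<and> (s ! \<alpha> = p \<and> s ! \<beta> = q \<or> s ! swap_col \<alpha> = p \<and> s ! swap_col \<beta> = q)"
      by (simp add: occ_def keys_def mem_def image_iff)
    then show ?thesis using Inl t un[of s] by blast
  next
    case (Inr ik)
    then have "fst (mem \<kappa> r) = fst (mem \<kappa> s)" for r s by (simp add: mem_def split_beta)
    then have "\<kappa> \<notin> occ \<alpha> \<beta> p q" using pq(3) unfolding occ_def by fastforce
    then show ?thesis using Inr by simp
  qed
  then have "occ \<alpha> \<beta> p q = {Inl t}" by blast
  then show ?thesis by simp
qed

text \<open>The players of a frame game lie in different holes, so inside a hole only its own four
  local games count. What remains is a check of a fixed table.\<close>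

lemma card_occ_same:
  assumes ab: "\<alpha> < 4" "\<beta> < 4" "\<alpha> \<noteq> \<beta>" and i: "i < n"
  shows "card (occ \<alpha> \<beta> (i, a) (i, b)) = card {k \<in> {..<4}. local_game k ! \<alpha> = a \<and> local_game k ! \<beta> = b \<or>
     local_game k ! swap_col \<alpha> = a \<and> local_game k ! swap_col \<beta> = b}" (is "_ = card ?K")
proof -
  have sc: "swap_col \<alpha> < 5" "swap_col \<beta> < 5" "swap_col \<alpha> \<noteq> swap_col \<beta>"
    using ab by (auto simp: swap_col_def less_Suc_eq eval_nat_numeral)
  have hole_neq: "fst (t ! \<alpha>) \<noteq> fst (t ! \<beta>)" "fst (t ! swap_col \<alpha>) \<noteq> fst (t ! swap_col \<beta>)" if "t \<in> H" for t
    using that hframe_nth_hole_neq[OF frame, of t] ab sc unfolding H_def by auto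
  have "\<kappa> \<in> occ \<alpha> \<beta> (i, a) (i, b) \<longleftrightarrow> \<kappa> \<in> Inr ` (Pair i ` ?K)" for \<kappa>
  proof (cases \<kappa>)
    case (Inl t)
    have "\<kappa> \<notin> occ \<alpha> \<beta> (i, a) (i, b)"
    proof
      assume "\<kappa> \<in> occ \<alpha> \<beta> (i, a) (i, b)"
      then have "t \<in> H" "t ! \<alpha> = (i, a) \<and> t ! \<beta> = (i, b) \<or> t ! swap_col \<alpha> = (i, a) \<and> t ! swap_col \<beta> = (i, b)"
        using Inl by (auto simp: occ_def keys_def mem_def)
      then show False using hole_neq[of t] by (metis fst_conv)
    qed
    then show ?thesis using Inl by auto
  next
    case (Inr jk)
    then show ?thesis using i by (cases jk) (auto simp: occ_def keys_def mem_def)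
  qed
  then have "occ \<alpha> \<beta> (i, a) (i, b) = Inr ` (Pair i ` ?K)" by blast
  then show ?thesis by (simp add: card_Inr_image card_image inj_on_def)
qed

lemma lessThan_4: "{..<4 :: nat} = {0, 1, 2, 3}"
  by auto

text \<open>The pair \<open>p = (i, k)\<close> is read twice: as the point whose frame games form
  the round, and as local game \<open>k\<close> of hole \<open>i\<close>, which completes it. The
  choice merely lists a finite set.\<close>

definition round_keys :: "nat \<times> nat \<Rightarrow> key list" where
  "round_keys p = Inr p # map Inl (SOME ts. distinct ts \<and> set ts = {t \<in> H. t ! 4 = p})"

definition short_keys :: "key list" where
  "short_keys = map (\<lambda>i. Inr (i, 3)) [0..<n]"

definition points :: "(nat \<times> nat) list" where
  "points = List.product [0..<n] [0..<3]"

definition rounds :: "key list list" where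
  "rounds = map round_keys points @ [short_keys]"

lemma finite_H: "finite H"
proof -
  have "H \<subseteq> {t. set t \<subseteq> P \<and> length t = 5}"
    using hframeD(2,3)[OF frame] unfolding H_def by auto
  then show ?thesis by (rule finite_subset) (simp add: finite_lists_length_eq)
qed

lemma round_keys: "distinct (round_keys p)" "set (round_keys p) = insert (Inr p) (Inl ` {t \<in> H. t ! 4 = p})"
proof -
  have "\<exists>ts. distinct ts \<and> set ts = {t \<in> H. t ! 4 = p}"
    using finite_distinct_list[of "{t \<in> H. t ! 4 = p}"] finite_H by auto
  then have "distinct (SOME ts. distinct ts \<and> set ts = {t \<in> H. t ! 4 = p}) \<and>
      set (SOME ts. distinct ts \<and> set ts = {t \<in> H. t ! 4 = p}) = {t \<in> H. t ! 4 = p}"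
    by (rule someI_ex)
  then show "distinct (round_keys p)" "set (round_keys p) = insert (Inr p) (Inl ` {t \<in> H. t ! 4 = p})"
    unfolding round_keys_def by (auto simp: distinct_map)
qed

lemma points: "distinct points" "set points = P"
  unfolding points_def by (auto simp: distinct_product)

lemma short_keys: "distinct short_keys" "set short_keys = Inr ` ({..<n} \<times> {3})"
  unfolding short_keys_def by (auto simp: distinct_map inj_on_def)

lemma rounds: "distinct (concat rounds)" "set (concat rounds) = keys"
proof -
  have "distinct (concat (map round_keys points))"
    by (rule distinct_concat_map) (auto simp: points round_keys)
  moreover have "set (concat (map round_keys points)) \<inter> set short_keys = {}"
    by (auto simp: points round_keys short_keys)
  ultimately show "distinct (concat rounds)"
    unfolding rounds_def by (simp add: short_keys)
  have "{t \<in> H. t ! 4 \<in> P} = H"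
    using hframe_nth_in[OF frame] unfolding H_def by auto
  then have HU: "(\<Union>p\<in>P. Inl ` {t \<in> H. t ! 4 = p}) = (Inl ` H :: key set)" by blast
  have PU: "P \<union> {..<n} \<times> {3} = {..<n} \<times> {..<4}" by auto
  have UN: "(\<Union>p\<in>A. insert (Inr p) (F p)) = Inr ` A \<union> (\<Union>p\<in>A. F p)"
    for A and F :: "nat \<times> nat \<Rightarrow> key set" by blast
  have "set (concat rounds) = (\<Union>p\<in>P. insert (Inr p) (Inl ` {t \<in> H. t ! 4 = p})) \<union> Inr ` ({..<n} \<times> {3})"
    unfolding rounds_def by (simp add: points round_keys short_keys)
  also have "\<dots> = Inl ` H \<union> Inr ` (P \<union> {..<n} \<times> {3})"
    unfolding UN HU image_Un by (simp only: Un_ac)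
  finally show "set (concat rounds) = keys" unfolding PU keys_def .
qed

section \<open>The counts prescribed for a CMDRR\<close>

lemma count_eq_card_occ:
  assumes "m < 3 * n" "w < 3 * n" "\<alpha> < 4" "\<beta> < 4"
    "\<And>\<kappa>. \<kappa> \<in> keys \<Longrightarrow> \<phi> (game_of \<kappa>) \<longleftrightarrow> num (mem \<kappa> \<alpha>) = m \<and> num (mem \<kappa> \<beta>) = w \<or>
        num (mem \<kappa> (swap_col \<alpha>)) = m \<and> num (mem \<kappa> (swap_col \<beta>)) = w"
  shows "length (filter \<phi> (map game_of (concat rounds))) = card (occ \<alpha> \<beta> (pt m) (pt w))"
proof -
  have sc: "swap_col \<alpha> < 4" "swap_col \<beta> < 4"
    using assms(3,4) by (auto simp: swap_col_def less_Suc_eq eval_nat_numeral)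
  have "{\<kappa> \<in> keys. \<phi> (game_of \<kappa>)} = occ \<alpha> \<beta> (pt m) (pt w)"
    unfolding occ_def using assms mem_in sc num_eq_pt_iff by blast
  then show ?thesis by (simp only: length_filter_map_card[OF rounds(1)] rounds(2))
qed

lemma counts:
  assumes "m < 3 * n" "w < 3 * n"
  shows "partner_count (map game_of (concat rounds)) m w = card (occ 0 2 (pt m) (pt w))"
    "opp_count (map game_of (concat rounds)) m w = card (occ 0 3 (pt m) (pt w))"
    "men_opp_count (map game_of (concat rounds)) m w = card (occ 0 1 (pt m) (pt w))"
    "women_opp_count (map game_of (concat rounds)) m w = card (occ 2 3 (pt m) (pt w))"
  unfolding partner_count_def opp_count_def men_opp_count_def women_opp_count_def
  using assms by (intro count_eq_card_occ; auto simp: game_of_def swap_col_def)+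

lemma partner_opp_same:
  assumes "i < n" "a < 3" "b < 3" "(a, b) \<noteq> (0, 0)"
  shows "card (occ 0 2 (i, a) (i, b)) = 1" "card (occ 0 3 (i, a) (i, b)) = 1"
  using assms unfolding less_3_cases
  by (auto simp: card_occ_same lessThan_4 local_game_def swap_col_def Collect_disj_eq Collect_conj_eq
      conj_disj_distribR conj_disj_distribL cong: conj_cong)

text \<open>The unmarried women meet in the first two local games, the unmarried men in the last
  two.\<close>

lemma same_sex_same:
  assumes "i < n" "a < 3" "b < 3" "a \<noteq> b"
  shows "card (occ 0 1 (i, a) (i, b)) = (if a = 0 \<or> b = 0 then 1 else 2)"
    "card (occ 2 3 (i, a) (i, b)) = (if a = 0 \<or> b = 0 then 1 else 2)"
  using assms unfolding less_3_cases
  by (auto simp: card_occ_same lessThan_4 local_game_def swap_col_def Collect_disj_eq Collect_conj_eq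
      conj_disj_distribR conj_disj_distribL cong: conj_cong)

lemma same_sex:
  assumes cnt: "\<And>x y. x < 3 * n \<Longrightarrow> y < 3 * n \<Longrightarrow> cnt x y = card (occ \<alpha> \<beta> (pt x) (pt y))"
    and ab: "(\<alpha>, \<beta>) \<in> {(0, 1), (2, 3)}"
  shows "same_sex_cond (3 * n) n cnt"
proof -
  have c: "cnt x y = (if fst (pt x) = fst (pt y) \<and> snd (pt x) \<noteq> 0 \<and> snd (pt y) \<noteq> 0 then 2 else 1)"
    if "x < 3 * n" "y < 3 * n" "x \<noteq> y" for x y
  proof -
    have ne: "pt x \<noteq> pt y" using that num_pt by metis
    obtain i a j b where p: "pt x = (i, a)" "pt y = (j, b)" by (metis prod.exhaust)
    have r: "i < n" "a < 3" "j < n" "b < 3" using pt_in[OF that(1)] pt_in[OF that(2)] p by auto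
    show ?thesis
    proof (cases "i = j")
      case True
      then show ?thesis using cnt[OF that(1,2)] same_sex_same[of i a b] r ne p ab by auto
    next
      case False
      then show ?thesis
        using cnt[OF that(1,2)] card_occ_diff[of \<alpha> \<beta> "pt x" "pt y"] r p ab by auto
    qed
  qed
  have s0: "snd (pt x) = 0" if "x < n" for x using that by (simp add: pt_def)
  show ?thesis
    unfolding same_sex_cond_def
  proof (intro allI impI conjI)
    fix x y assume "x < 3 * n" "x < n" "y < 3 * n" "y \<noteq> x"
    then show "cnt x y = 1" using c[of x y] s0[of x] by auto
  next
    fix x assume x: "x < 3 * n" "n \<le> x"
    obtain i a where p: "pt x = (i, a)" by (metis prod.exhaust)
    have r: "i < n" "a < 3" using pt_in[OF x(1)] p by auto
    have a0: "a \<noteq> 0" using num_less_n[OF pt_in[OF x(1)]] num_pt[of x] p x by auto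
    \<comment> \<open>The map from \<open>a\<close> to \<open>3 - a\<close> exchanges 1 and 2, so
      \<open>q\<close> is the other unmarried point of the hole.\<close>
    define q where "q = (i, 3 - a)"
    have q: "q \<in> P" "snd q \<noteq> 0" "q \<noteq> pt x" using r a0 p unfolding q_def less_3_cases by auto
    define y where "y = num q"
    have y: "y < 3 * n" "pt y = q" using num_less[OF q(1)] pt_num[OF q(1)] by (auto simp: y_def)
    have "n \<le> y" using num_less_n[OF q(1)] q(2) unfolding y_def by simp
    moreover have "y \<noteq> x" using y q by auto
    moreover have "cnt x y = 2" using c[OF x(1) y(1)] \<open>y \<noteq> x\<close> y p q a0 by (auto simp: q_def)
    moreover have "cnt x z = 1" if z: "z < 3 * n" "z \<noteq> x \<and> z \<noteq> y" for z
    proof -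
      have "pt z \<in> P" "pt z \<noteq> pt x" "pt z \<noteq> q" using z pt_in num_pt y by metis+
      then have "\<not> (fst (pt x) = fst (pt z) \<and> snd (pt z) \<noteq> 0)"
        using r a0 p unfolding q_def by (cases "pt z") (auto simp: less_3_cases)
      then show ?thesis using c[OF x(1) z(1)] z by auto
    qed
    ultimately show "\<exists>y\<ge>n. y < 3 * n \<and> y \<noteq> x \<and> cnt x y = 2 \<and> (\<forall>z<3 * n. z \<noteq> x \<and> z \<noteq> y \<longrightarrow> cnt x z = 1)"
      using y(1) by blast
  qed
qed

text \<open>Spouses sit at one point with second coordinate 0. A frame game has its players at four
  different points, and in a local game a man and a woman share a point only at 1 or 2.\<close>

lemma valid:
  assumes "\<kappa> \<in> keys"
  shows "valid_game (3 * n) n (game_of \<kappa>)"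
proof -
  have P: "mem \<kappa> 0 \<in> P" "mem \<kappa> 1 \<in> P" "mem \<kappa> 2 \<in> P" "mem \<kappa> 3 \<in> P"
    using mem_in[OF assms] by auto
  have ne: "mem \<kappa> 0 \<noteq> mem \<kappa> 1 \<and> mem \<kappa> 2 \<noteq> mem \<kappa> 3 \<and>
     (\<forall>r\<in>{0, 1}. \<forall>s\<in>{2, 3}. mem \<kappa> r = mem \<kappa> s \<longrightarrow> snd (mem \<kappa> r) \<noteq> 0)"
  proof (cases \<kappa>)
    case (Inl t)
    then have "t \<in> Q" using assms by (auto simp: keys_def H_def)
    then have "t ! r \<noteq> t ! s" if "r < 5" "s < 5" "r \<noteq> s" for r s
      using hframe_nth_hole_neq[OF frame _ that] by metis
    then show ?thesis using Inl by (simp add: mem_def)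
  next
    case (Inr ik)
    then obtain i k where "\<kappa> = Inr (i, k)" "k < 4" using assms by (cases ik) (auto simp: keys_def)
    then show ?thesis by (auto simp: mem_def local_game_def less_Suc_eq eval_nat_numeral)
  qed
  have "\<not> spouses n (num p) (num q)" if "p \<in> P" "q \<in> P" "p = q \<longrightarrow> snd p \<noteq> 0" for p q
    using that num_eq_iff num_less_n unfolding spouses_def by metis
  then show ?thesis
    using ne P num_less num_eq_iff unfolding valid_game_def game_of_def by auto
qed

lemma cmdrr: "is_CMDRR (3 * n) n (map game_of (concat rounds))"
  unfolding is_CMDRR_def
proof (intro conjI ballI allI impI)
  show "n \<le> 3 * n" by simp
next
  fix g assume "g \<in> set (map game_of (concat rounds))"
  then show "valid_game (3 * n) n g" using valid rounds by (auto simp del: set_concat)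
next
  fix m w assume mw: "m < 3 * n" "w < 3 * n" and ns: "\<not> spouses n m w"
  obtain i a j b where p: "pt m = (i, a)" "pt w = (j, b)" by (metis prod.exhaust)
  have r: "i < n" "a < 3" "j < n" "b < 3" using pt_in[OF mw(1)] pt_in[OF mw(2)] p by auto
  have ne: "i = j \<Longrightarrow> (a, b) \<noteq> (0, 0)"
    using ns num_pt[of m] num_pt[of w] p r unfolding spouses_def by (auto simp: num_def)
  show "partner_count (map game_of (concat rounds)) m w = 1"
    using counts(1)[OF mw] partner_opp_same(1)[of i a b] card_occ_diff[of 0 2 "pt m" "pt w"] p r ne by (cases "i = j") auto
  show "opp_count (map game_of (concat rounds)) m w = 1"
    using counts(2)[OF mw] partner_opp_same(2)[of i a b] card_occ_diff[of 0 3 "pt m" "pt w"] p r ne by (cases "i = j") auto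
next
  show "same_sex_cond (3 * n) n (men_opp_count (map game_of (concat rounds)))"
    by (rule same_sex[OF counts(3)]) auto
  show "same_sex_cond (3 * n) n (women_opp_count (map game_of (concat rounds)))"
    by (rule same_sex[OF counts(4)]) auto
qed

section \<open>Properness and fullness of the rounds\<close>

lemma proper_column:
  assumes cols: "(\<alpha>, \<beta>) \<in> {(0, 1), (2, 3)}" and ks: "ks \<in> set rounds"
  shows "distinct (concat (map (\<lambda>\<kappa>. [num (mem \<kappa> \<alpha>), num (mem \<kappa> \<beta>)]) ks))"
proof -
  have sub: "set ks \<subseteq> keys" using ks rounds(2) by auto
  have ab: "\<alpha> < 4" "\<beta> < 4" "\<alpha> \<noteq> \<beta>" "swap_col \<alpha> = \<beta>" "swap_col \<beta> = \<alpha>" "swap_col 4 = 4"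
    using cols by (auto simp: swap_col_def)
  have own: "mem \<kappa> \<alpha> \<noteq> mem \<kappa> \<beta>" if "\<kappa> \<in> keys" for \<kappa>
    using valid[OF that] cols unfolding valid_game_def game_of_def by auto
  have disj: "\<kappa> = l" if kl: "\<kappa> \<in> set ks" "l \<in> set ks" "r \<in> {\<alpha>, \<beta>}" "s \<in> {\<alpha>, \<beta>}" "mem \<kappa> r = mem l s" for \<kappa> l r s
  proof (cases "ks = short_keys")
    \<comment> \<open>The short round has one game in each hole, and holes are disjoint.\<close>
    case True
    then show ?thesis using kl by (auto simp: short_keys mem_def)
  next
    case False
    then obtain p where p: "p \<in> P" "ks = round_keys p" using ks unfolding rounds_def by (auto simp: points)
    \<comment> \<open>The frame games of round \<open>p\<close> avoid the hole of \<open>p\<close>,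
      while the local game of this round stays inside it.\<close>
    have tp: "fst (t ! u) \<noteq> fst p" if "t \<in> H" "t ! 4 = p" "u \<in> {\<alpha>, \<beta>}" for t u
      using hframe_nth_hole_neq[OF frame, of t u 4] that ab unfolding H_def by auto
    have one: "t = t'" if "t \<in> H" "t' \<in> H" "t ! 4 = p" "t' ! 4 = p" "t ! r = t' ! s" for t t'
    proof -
      have "t ! r \<in> P" using hframe_nth_in[OF frame, of t r] that kl ab unfolding H_def by auto
      moreover have "fst (t ! r) \<noteq> fst p" using tp that kl by blast
      ultimately have "\<exists>!t''. t'' \<in> H \<and> (t'' ! r = t ! r \<and> t'' ! 4 = p \<or> t'' ! swap_col r = t ! r \<and> t'' ! swap_col 4 = p)"
        using half_ex1[of r 4 "t ! r" p] kl ab p(1) by auto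
      \<comment> \<open>\<open>swap_col\<close> exchanges the two columns and fixes column 4, so
        \<open>t'\<close> satisfies the disjunction of \<open>half_ex1\<close> whichever column
        \<open>s\<close> is.\<close>
      moreover have "s = r \<or> s = swap_col r" using kl ab by auto
      ultimately show ?thesis using that ab by metis
    qed
    show ?thesis
    proof (cases \<kappa>; cases l)
      fix t t' assume tt: "\<kappa> = Inl t" "l = Inl t'"
      then have "t \<in> H" "t' \<in> H" "t ! 4 = p" "t' ! 4 = p" "t ! r = t' ! s"
        using kl p(2) by (auto simp: round_keys mem_def)
      then show ?thesis using one tt by blast
    next
      fix t q assume tq: "\<kappa> = Inl t" "l = Inr q"
      then have "t \<in> H" "t ! 4 = p" "q = p" "t ! r = mem l s"
        using kl p(2) by (auto simp: round_keys mem_def)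
      moreover have "fst (mem l s) = fst q" using tq by (simp add: mem_def split_beta)
      ultimately show ?thesis using tp[of t r] kl by auto
    next
      fix t q assume tq: "\<kappa> = Inr q" "l = Inl t"
      then have "t \<in> H" "t ! 4 = p" "q = p" "t ! s = mem \<kappa> r"
        using kl p(2) by (auto simp: round_keys mem_def)
      moreover have "fst (mem \<kappa> r) = fst q" using tq by (simp add: mem_def split_beta)
      ultimately show ?thesis using tp[of t s] kl by auto
    next
      fix q q' assume "\<kappa> = Inr q" "l = Inr q'"
      then show ?thesis using kl p(2) by (auto simp: round_keys)
    qed
  qed
  have mP: "mem \<kappa> \<alpha> \<in> P" "mem \<kappa> \<beta> \<in> P" if "\<kappa> \<in> set ks" for \<kappa>
    using mem_in that sub ab by blast+
  have "distinct ks" using ks round_keys short_keys unfolding rounds_def by auto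
  then show ?thesis
  proof (rule distinct_concat_map)
    fix \<kappa> assume k: "\<kappa> \<in> set ks"
    then show "distinct [num (mem \<kappa> \<alpha>), num (mem \<kappa> \<beta>)]"
      using own sub num_eq_iff[OF mP[OF k]] by auto
  next
    fix \<kappa> l assume kl: "\<kappa> \<in> set ks" "l \<in> set ks" "\<kappa> \<noteq> l"
    have "mem \<kappa> r \<noteq> mem l s" if "r \<in> {\<alpha>, \<beta>}" "s \<in> {\<alpha>, \<beta>}" for r s
      using disj[OF kl(1,2) that] kl(3) by blast
    then show "set [num (mem \<kappa> \<alpha>), num (mem \<kappa> \<beta>)] \<inter> set [num (mem l \<alpha>), num (mem l \<beta>)] = {}"
      using num_eq_iff mP[OF kl(1)] mP[OF kl(2)] by auto
  qed
qed

lemma proper: "ks \<in> set rounds \<Longrightarrow> proper_round (map game_of ks)"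
  using proper_column[of 0 1 ks] proper_column[of 2 3 ks]
  unfolding proper_round_def by (simp add: game_of_def comp_def)

text \<open>The frame games of the round cover all \<open>3 * (n - 1)\<close> points outside the
  hole of \<open>p\<close>, and the local game adds two of the three points inside.\<close>

lemma column_image:
  assumes cols: "(\<alpha>, \<beta>) \<in> {(0, 1), (2, 3)}" and p: "p \<in> P"
  shows "card ((\<lambda>\<kappa>. num (mem \<kappa> \<alpha>)) ` set (round_keys p) \<union> (\<lambda>\<kappa>. num (mem \<kappa> \<beta>)) ` set (round_keys p)) = 3 * n - 1"
proof -
  obtain i k where ik: "p = (i, k)" "i < n" "k < 3" using p by (cases p) auto
  have ab: "\<alpha> < 4" "\<beta> < 4" "\<alpha> \<noteq> \<beta>" "swap_col \<alpha> = \<beta>" "swap_col \<beta> = \<alpha>" "swap_col 4 = 4"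
    using cols by (auto simp: swap_col_def)
  define L where "L = {i} \<times> {local_game k ! \<alpha>, local_game k ! \<beta>}"
  define Z where "Z = ({..<n} - {i}) \<times> {..<3 :: nat}"
  let ?A = "(\<lambda>\<kappa>. mem \<kappa> \<alpha>) ` set (round_keys p) \<union> (\<lambda>\<kappa>. mem \<kappa> \<beta>) ` set (round_keys p)"
  have A: "?A = L \<union> Z"
  proof (intro equalityI subsetI)
    fix x assume "x \<in> ?A"
    then obtain \<kappa> r where k: "\<kappa> \<in> set (round_keys p)" "r \<in> {\<alpha>, \<beta>}" "x = mem \<kappa> r" by blast
    show "x \<in> L \<union> Z"
    proof (cases \<kappa>)
      case (Inl t)
      then have t: "t \<in> Q" "t ! 4 = p" using k by (auto simp: round_keys H_def)
      then have "t ! r \<in> P" "fst (t ! r) \<noteq> i"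
        using hframe_nth_in[OF frame t(1), of r] hframe_nth_hole_neq[OF frame t(1), of r 4] k ab ik by auto
      then show ?thesis using k Inl unfolding Z_def by (auto simp: mem_def mem_Times_iff)
    next
      case (Inr q)
      then show ?thesis using k ik unfolding L_def by (auto simp: round_keys mem_def)
    qed
  next
    fix x assume "x \<in> L \<union> Z"
    then show "x \<in> ?A"
    proof
      assume "x \<in> L"
      then show ?thesis unfolding L_def round_keys using ik by (auto simp: mem_def)
    next
      assume "x \<in> Z"
      then have x: "x \<in> P" "fst x \<noteq> fst p" unfolding Z_def ik by auto
      obtain t where "t \<in> H" "t ! \<alpha> = x \<and> t ! 4 = p \<or> t ! swap_col \<alpha> = x \<and> t ! swap_col 4 = p"
        using half_ex1[of \<alpha> 4 x p] x p ab by auto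
      then have "Inl t \<in> set (round_keys p)" "mem (Inl t) \<alpha> = x \<or> mem (Inl t) \<beta> = x"
        using ab by (auto simp: round_keys mem_def)
      then show ?thesis by blast
    qed
  qed
  have sub: "L \<union> Z \<subseteq> P"
    using ik local_game_less[of k] ab unfolding L_def Z_def by auto
  have "local_game k ! \<alpha> \<noteq> local_game k ! \<beta>"
    using ik cols unfolding less_3_cases by (auto simp: local_game_def)
  then have "card L = 2" unfolding L_def by (simp add: card_cartesian_product)
  moreover have "card Z = (n - 1) * 3" using ik unfolding Z_def by (simp add: card_cartesian_product)
  moreover have "card (L \<union> Z) = card L + card Z"
    by (rule card_Un_disjoint) (auto simp: L_def Z_def)
  ultimately have "card (L \<union> Z) = 3 * n - 1" using n_pos by simp
  moreover have "inj_on num (L \<union> Z)"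
    using num_eq_iff sub unfolding inj_on_def by blast
  ultimately have "card (num ` (L \<union> Z)) = 3 * n - 1" by (simp add: card_image)
  moreover have "num ` ?A = (\<lambda>\<kappa>. num (mem \<kappa> \<alpha>)) ` set (round_keys p) \<union> (\<lambda>\<kappa>. num (mem \<kappa> \<beta>)) ` set (round_keys p)"
    by (simp add: image_Un image_image)
  ultimately show ?thesis using A by simp
qed

lemma full:
  assumes "p \<in> P"
  shows "full_round (3 * n) (map game_of (round_keys p))"
proof -
  let ?S = "set (round_keys p)"
  let ?M = "(\<lambda>\<kappa>. num (mem \<kappa> 0)) ` ?S \<union> (\<lambda>\<kappa>. num (mem \<kappa> 1)) ` ?S"
  let ?W = "(\<lambda>\<kappa>. num (mem \<kappa> 2)) ` ?S \<union> (\<lambda>\<kappa>. num (mem \<kappa> 3)) ` ?S"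
  have "round_players (map game_of (round_keys p)) = ?M <+> ?W"
    unfolding round_players_def game_of_def by auto
  then have "card (round_players (map game_of (round_keys p))) = card ?M + card ?W"
    by (simp add: card_Plus)
  also have "\<dots> = 2 * (3 * n) - 2"
    using column_image[of 0 1 p] column_image[of 2 3 p] assms n_pos by simp
  \<comment> \<open>\<open>3 * n\<close> is odd, so a full round omits two players: one man and one
    woman of the hole of \<open>p\<close>.\<close>
  finally show ?thesis using odd unfolding full_round_def by simp
qed

theorem tournament: "fully_resolvable_CMDRR_exists (3 * n) n"
  unfolding fully_resolvable_CMDRR_exists_def
proof (intro exI conjI)
  show "is_CMDRR (3 * n) n (concat (map (map game_of) rounds))"
    using cmdrr by (simp add: map_concat)
  \<comment> \<open>The rounds of points are all full, so only the round of
    \<open>short_keys\<close> can be short.\<close>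
  have "filter (\<lambda>r. \<not> full_round (3 * n) r) (map (map game_of) (map round_keys points)) = []"
    using full by (auto simp: filter_empty_conv points)
  then have "length (filter (\<lambda>r. \<not> full_round (3 * n) r) (map (map game_of) rounds)) \<le> 1"
    unfolding rounds_def by (simp del: map_map)
  then show "full_resolution (3 * n) (map (map game_of) rounds)"
    unfolding full_resolution_def using proper by auto
qed

end

section \<open>Frames with holes of size three\<close>

text \<open>Slope differences in a design with eight groups are below 7, so their prime factors are
  2, 3 and 5.\<close>

lemma coprime_small:
  fixes m d :: nat
  assumes "odd m" "m mod 3 \<noteq> 0" "m mod 5 \<noteq> 0" "0 < d" "d < 7"
  shows "coprime d m"
proof -
  have 2: "coprime 2 m" using assms(1) by simp
  have 3: "coprime 3 m" and 5: "coprime 5 m"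
    using assms(2,3) by (auto intro!: prime_imp_coprime simp: dvd_eq_mod_eq_0)
  have "coprime (2 * 2) m" "coprime (2 * 3) m" using 2 3 by (simp_all only: coprime_mult_left_iff simp_thms)
  moreover have "d = 1 \<or> d = 2 \<or> d = 3 \<or> d = 2 * 2 \<or> d = 5 \<or> d = 2 * 3" using assms(4,5) by auto
  ultimately show ?thesis using 2 3 5 by (elim disjE) (simp_all only: coprime_1_left)
qed

text \<open>The interval from \<open>5 m\<close> to \<open>8 m\<close> is long enough for sizes
  prime to 30 to cover everything. The value \<open>5 m + 1\<close> is skipped, since a remainder of
  1 forces a group of size 1. Up to 424 a few sizes suffice; beyond, one of \<open>30 q + 1\<close>
  and \<open>30 q - 1\<close> works.\<close>

lemma choose_group_size:
  fixes u :: nat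
  assumes "u = 35 \<or> 37 \<le> u"
  obtains m where "7 \<le> m" "odd m" "m mod 3 \<noteq> 0" "m mod 5 \<noteq> 0" "5 * m \<le> u" "u \<le> 8 * m" "u \<noteq> 5 * m + 1"
proof (cases "u \<le> 424")
  case True
  then consider "u \<le> 56" | "57 \<le> u" "u \<le> 88" | "89 \<le> u" "u \<le> 136" | "137 \<le> u" "u \<le> 184" | "185 \<le> u" "u \<le> 248"
    | "249 \<le> u" "u \<le> 376" | "377 \<le> u" "u \<le> 424" by linarith
  then show thesis
  proof cases
    case 1 then show thesis using assms by (intro that[of 7]) auto
  next
    case 2 then show thesis by (intro that[of 11]) auto
  next
    case 3 then show thesis by (intro that[of 17]) auto
  next
    case 4 then show thesis by (intro that[of 23]) auto
  next
    case 5 then show thesis by (intro that[of 31]) auto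
  next
    case 6 then show thesis by (intro that[of 47]) auto
  next
    case 7 then show thesis by (intro that[of 53]) auto
  qed
next
  case False
  \<comment> \<open>With this \<open>q\<close>, \<open>u div 5\<close> lies between
    \<open>30 * q + 1\<close> and \<open>30 * q + 30\<close>; as \<open>q\<close> is at least 2, the
    upper bound for \<open>u\<close> is below \<open>8 * (30 * q + 1)\<close>.\<close>
  define q where "q = (u div 5 - 1) div 30"
  have "u = 5 * (u div 5) + u mod 5" "u mod 5 < 5"
    "u div 5 - 1 = 30 * q + (u div 5 - 1) mod 30" "(u div 5 - 1) mod 30 < 30"
    unfolding q_def by simp_all
  then have q: "2 \<le> q" "150 * q + 5 \<le> u" "u \<le> 150 * q + 154" using False by linarith+
  show thesis
  proof (cases "u = 150 * q + 6")
    \<comment> \<open>Here \<open>u\<close> exceeds \<open>5 * (30 * q + 1)\<close> by exactly 1, so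
      the next smaller size prime to 30 is taken.\<close>
    case True
    show thesis
    proof (rule that[of "30 * q - 1"])
      show "odd (30 * q - 1)" "(30 * q - 1) mod 3 \<noteq> 0" "(30 * q - 1) mod 5 \<noteq> 0" using q(1) by presburger+
    qed (use q True in auto)
  next
    case False
    show thesis
    proof (rule that[of "30 * q + 1"])
      show "odd (30 * q + 1)" "(30 * q + 1) mod 3 \<noteq> 0" "(30 * q + 1) mod 5 \<noteq> 0" by presburger+
    qed (use q False in auto)
  qed
qed

text \<open>Size 1 is excluded because no frame has exactly three holes.\<close>

lemma split_truncated:
  fixes r m :: nat
  assumes "r \<le> 3 * m" "r \<noteq> 1" "7 \<le> m"
  obtains a b c where "r = a + b + c" "a \<le> m" "b \<le> m" "c \<le> m" "a \<noteq> 1" "b \<noteq> 1" "c \<noteq> 1"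
proof -
  consider "r \<le> m" | "r = m + 1" | "m + 2 \<le> r" "r \<le> 2 * m" | "r = 2 * m + 1" | "2 * m + 2 \<le> r" by linarith
  then show thesis
  proof cases
    case 1 then show thesis using assms by (intro that[of r 0 0]) auto
  next
    case 2 then show thesis using assms by (intro that[of "m - 1" 2 0]) auto
  next
    case 3 then show thesis using assms by (intro that[of m "r - m" 0]) auto
  next
    case 4 then show thesis using assms by (intro that[of m "m - 1" 2]) auto
  next
    case 5 then show thesis using assms by (intro that[of m m "r - 2 * m"]) auto
  qed
qed

text \<open>Strong induction applies because every nonempty group has at least two points and fewer
  than \<open>u\<close>.\<close>

lemma uniform_frame_3:
  assumes "2 \<le> u"
  shows "uniform_frame 3 (2 * u + 1)"
  using assms
proof (induction u rule: less_induct)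
  case (less u)
  have six: "uniform_frame 6 c" if "5 \<le> c" "c \<le> 8" for c
  proof -
    have "c = 5 \<or> c = 6 \<or> c = 7 \<or> c = 8" using that by auto
    then show ?thesis using frames_6 by auto
  qed
  have "u = 35 \<or> 37 \<le> u"
    if "\<not> (u \<le> 24 \<or> u = 26 \<or> u = 31 \<or> u = 32 \<or> u = 33 \<or> u = 34 \<or> u = 36)"
      "\<not> (u = 25 \<or> u = 27 \<or> u = 28 \<or> u = 29 \<or> u = 30)"
    using that by presburger
  then consider "u \<le> 24 \<or> u = 26 \<or> u = 31 \<or> u = 32 \<or> u = 33 \<or> u = 34 \<or> u = 36"
    | "u = 25 \<or> u = 27 \<or> u = 28 \<or> u = 29 \<or> u = 30" | "u = 35 \<or> 37 \<le> u"
    by blast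
  then show ?case
  proof cases
    case 1
    then show ?thesis using base_frames less.prems by blast
  next
    case 2
    \<comment> \<open>Five groups of size 5 stay whole, and the slope group keeps
      \<open>u - 25\<close> points; this is never 1, since 26 is not among these values.\<close>
    define sz where "sz j = (if j = 5 then u - 25 else 5)" for j :: nat
    have "{..5 :: nat} = {0, 1, 2, 3, 4, 5}" by auto
    then have sum: "(\<Sum>j\<le>5. sz j) = u" using 2 by (auto simp: sz_def)
    have "uniform_frame 3 (2 * (\<Sum>j\<le>5. sz j) + 1)"
    proof (rule frame_recursion[where m = 5])
      show "coprime d 5" if "0 < d" "d < 5" for d :: nat
      proof -
        have "d = 1 \<or> d = 2 \<or> d = 3 \<or> d = 4" using that by auto
        then show ?thesis by (auto simp: coprime_iff_gcd_eq_1 gcd_non_0_nat)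
      qed
      show "uniform_frame 3 (2 * sz j + 1)" if "sz j > 0" for j
        using that 2 by (intro less.IH) (auto simp: sz_def split: if_splits)
    qed (use 2 six in \<open>auto simp: sz_def\<close>)
    then show ?thesis unfolding sum .
  next
    case 3
    obtain m where m: "7 \<le> m" "odd m" "m mod 3 \<noteq> 0" "m mod 5 \<noteq> 0" "5 * m \<le> u" "u \<le> 8 * m" "u \<noteq> 5 * m + 1"
      using choose_group_size[OF 3] by blast
    obtain a b c where abc: "u - 5 * m = a + b + c" "a \<le> m" "b \<le> m" "c \<le> m" "a \<noteq> 1" "b \<noteq> 1" "c \<noteq> 1"
      by (rule split_truncated[of "u - 5 * m" m]) (use m in auto)
    \<comment> \<open>The last three groups, the slope group among them, absorb the excess over
      \<open>5 * m\<close>.\<close>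
    define sz where "sz j = (if j = 5 then a else if j = 6 then b else if j = 7 then c else m)" for j :: nat
    have "{..7 :: nat} = {0, 1, 2, 3, 4, 5, 6, 7}" by auto
    then have sum: "(\<Sum>j\<le>7. sz j) = u" using abc(1) m(5) by (auto simp: sz_def)
    have "uniform_frame 3 (2 * (\<Sum>j\<le>7. sz j) + 1)"
    proof (rule frame_recursion[where m = m])
      show "coprime d m" if "0 < d" "d < 7" for d
        using coprime_small m that by blast
      show "uniform_frame 3 (2 * sz j + 1)" if "sz j > 0" for j
        using that m abc by (intro less.IH) (auto simp: sz_def split: if_splits)
    qed (use m abc six in \<open>auto simp: sz_def\<close>)
    then show ?thesis unfolding sum .
  qed
qed

theorem theorem8:
  fixes n :: nat
  assumes "odd n" and "n \<ge> 5"
  shows "fully_resolvable_CMDRR_exists (3 * n) n"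
proof -
  obtain u where u: "n = 2 * u + 1" using assms(1) by (rule oddE)
  have "uniform_frame 3 n" using uniform_frame_3[of u] u assms(2) by simp
  then obtain Q :: "(nat \<times> nat) list set" where "hframe ({..<n} \<times> {..<3}) fst Q" unfolding uniform_frame_def by blast
  then interpret triple_frame n Q by unfold_locales (use assms in auto)
  show ?thesis by (rule tournament)
qed

end
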